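(* Let $\lambda=e^{2\pi i\theta}$ be a complex number of modulus one which is not a root of unity, and let $\mathcal A(S^3_\theta)$ be the $*$-algebra generated by normal elements $a,b$ with $ab=\lambda ba$, $ab^*=\bar\lambda b^*a$, $aa^*+bb^*=1$, represented on $\mathcal H$ with the Dirac operator $D$ (with parameters $r,\alpha$ real and $s$ an arbitrary complex number) as described in the context. Then the one-form $$\omega=\frac r2\big(a^*[D,a]+b[D,b^*]\big)$$ is a strong connection for the spectral triple over the noncommutative $U(1)$-bundle $\mathcal A(S^2)\hookrightarrow\mathcal A(S^3_\theta)$, and the Dirac operator $D$ is compatible with $\omega$, i.e. the twisted operator $D_\omega$ and the horizontal Dirac operator $D_h$ coincide on a dense subset of $\mathcal H$.
   Context: $\mathcal H$ has orthonormal basis $|l,m,n,\pm\rangle$, $l=0,\frac12,1,\dots$, $m,n\in\{-l,-l+1,\dots,l\}$. Write $x^\pm=x\pm\frac12$ for $x=l,m,n$. The algebra acts diagonally (same formula on $+$ and $-$ components) by $$a|l,m,n\rangle=\lambda^{-n}\Big(\tfrac{\sqrt{l+1+m}\sqrt{l+1-n}}{\sqrt{2l+1}\sqrt{2l+2}}|l^+,m^+,n^-\rangle-\tfrac{\sqrt{l-m}\sqrt{l+n}}{\sqrt{2l}\sqrt{2l+1}}|l^-,m^+,n^-\rangle\Big),$$ $$b|l,m,n\rangle=\lambda^{n}\Big(\tfrac{\sqrt{l+1-m}\sqrt{l+1-n}}{\sqrt{2l+1}\sqrt{2l+2}}|l^+,m^-,n^-\rangle+\tfrac{\sqrt{l+m}\sqrt{l+n}}{\sqrt{2l}\sqrt{2l+1}}|l^-,m^-,n^-\rangle\Big)$$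 (the second terms being absent for $l=0$), with $\lambda^{x}:=e^{2\pi i\theta x}$. The antiunitary $J$ is $J|l,m,n,\pm\rangle=\pm i^{2(m+n)}|l,-m,-n,\mp\rangle$. The Dirac operator is $$D|l,m,n,+\rangle=\big(r(m+\tfrac12)+\tfrac\alpha4\big)|l,m,n,+\rangle+s\sqrt{l+1+m}\sqrt{l-m}\,|l,m+1,n,-\rangle,$$ $$D|l,m,n,-\rangle=\big(-r(m-\tfrac12)+\tfrac\alpha4\big)|l,m,n,-\rangle+\bar s\sqrt{l-m+1}\sqrt{l+m}\,|l,m-1,n,+\rangle;$$ it satisfies $JD=DJ$. The $U(1)$-action is generated by $\delta|l,m,n,\pm\rangle=(2m\pm1)|l,m,n,\pm\rangle$, inducing on the algebra the derivation $\delta(a)=a$, $\delta(b)=-b$ (so $\delta(a^* )=-a^*$, $\delta(b^* )=b^*$). $\mathcal A^{(k)}=\{x:\delta(x)=kx\}$; the invariant subalgebra $\mathcal A^{(0)}$ is generated by $B=ba$, $B^*$ and $A=aa^*-\frac12$, is commutative with $A^2+BB^*=\frac14$, and is denoted $\mathcal A(S^2)$. $\Gamma|l,m,n,\pm\rangle=\pm|l,m,n,\pm\rangle$, $D_h=\frac12\Gamma[\Gamma,D]$; one has $D=D_h+\frac r2\Gamma\delta+\frac\alpha4\,\mathrm{id}$ on a dense subset (fibers of constant length $\frac2r$). $\mathcal H_k$ is the $k$-eigenspace of $\delta$. $\Omega^1_D(\mathcal A)$ (resp. $\Omega^1_D(\mathcal B)$, where $\mathcal A=\mathcal A(S^3_\theta)$,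 $\mathcal B=\mathcal A(S^2)$) is the span of $x'[D,x]$, $x,x'\in\mathcal A$ (resp. $\mathcal B$). A strong connection is $\omega\in\Omega^1_D(\mathcal A)$ with: $[\delta,\omega]=0$; $\sum_ip_i\delta(q_i)=1$ whenever $\omega=\sum_ip_i[D,q_i]$, $p_i,q_i\in\mathcal A$ (vertical field condition); and $\nabla_\omega(x):=[D,x]-\delta(x)\omega\in\Omega^1_D(\mathcal B)\mathcal A$ for all $x\in\mathcal A$. Right actions: $hx:=Jx^*J^{-1}h$ for $x\in\mathcal A$; $h\eta:=-J\eta^*J^{-1}h$ for $\eta\in\Omega^1_D(\mathcal B)$; $h(\eta x)=(h\eta)x$. The twisted operator $D_\omega$ is determined on the span of the vectors $hx$ ($h\in\mathcal H_0$ in the domain of $D_h$, $x\in\mathcal A^{(k)}$, $k\in\mathbb Z$) by $D_\omega(hx)=(D_hh)x+h\nabla_\omega(x)$.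
   Formalization: The prefactor r/2 of ω is dropped and r ≠ 0 is assumed: as a*a+bb*=1, the vertical field condition applied to the printed ω gives r/2 = 1, so the printed claim fails for every r ≠ 2 (at r = 0 the form is 0); at r = 2 the two formulas agree. *)

theory Defs
  imports "HOL-Analysis.Analysis" "HOL-Library.Function_Algebras"
begin

subsection \<open>The Hilbert space\<close>

datatype spin = Plus | Minus

primrec spin_sign :: "spin \<Rightarrow> real" where
  "spin_sign Plus = 1"
| "spin_sign Minus = - 1"

primrec flip :: "spin \<Rightarrow> spin" where
  "flip Plus = Minus"
| "flip Minus = Plus"

text \<open>Labels \<open>(l, m, n, \<plusminus>)\<close>: \<open>l = 0, 1/2, 1, \<dots>\<close> and \<open>m, n \<in> {-l, -l + 1, \<dots>, l}\<close>.\<close>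

typedef label =
  "{(l :: real, m :: real, n :: real, \<sigma> :: spin).
      2 * l \<in> \<nat> \<and> l + m \<in> \<nat> \<and> l - m \<in> \<nat> \<and> l + n \<in> \<nat> \<and> l - n \<in> \<nat>}"
  by (rule exI[of _ "(0, 0, 0, Plus)"]) auto

text \<open>A vector is its family of coefficients in the orthonormal basis; \<open>hilb\<close> is the space of
  square-summable families. All operators below have matrices with finitely many non-zero entries
  in each row and each column. They therefore act on arbitrary families, can be composed without
  domain restrictions, and are determined by their values on basis vectors. Boundedness and
  domains are recovered by restricting to \<open>hilb\<close>. Addition and subtraction
  of vectors and of operators are pointwise.\<close>

type_synonym vec = "label \<Rightarrow> complex"
type_synonym oper = "vec \<Rightarrow> vec"

abbreviation oper_comp :: "oper \<Rightarrow> oper \<Rightarrow> oper" (infixl \<open>\<cdot>\<close> 70) where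
  "S \<cdot> T \<equiv> S \<circ> T"

definition hilb :: "vec set" where
  "hilb = {v. (\<lambda>i. (cmod (v i))\<^sup>2) summable_on UNIV}"

definition hnorm :: "vec \<Rightarrow> real" where
  "hnorm v = sqrt (\<Sum>\<^sub>\<infinity>i. (cmod (v i))\<^sup>2)"

definition dense_in_hilb :: "vec set \<Rightarrow> bool" where
  "dense_in_hilb S \<longleftrightarrow> S \<subseteq> hilb \<and> (\<forall>v\<in>hilb. \<forall>\<epsilon>>0. \<exists>w\<in>S. hnorm (v - w) < \<epsilon>)"

definition scaleV :: "complex \<Rightarrow> vec \<Rightarrow> vec" (infixr \<open>*\<^sub>V\<close> 75) where
  "c *\<^sub>V v = (\<lambda>i. c * v i)"

definition scaleO :: "complex \<Rightarrow> oper \<Rightarrow> oper" (infixr \<open>*\<^sub>O\<close> 75) where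
  "c *\<^sub>O T = (\<lambda>v. c *\<^sub>V T v)"

definition unit_vec :: "label \<Rightarrow> vec" where
  "unit_vec j = (\<lambda>i. if i = j then 1 else 0)"

text \<open>\<open>ket l m n \<sigma>\<close> is the basis vector \<open>|l, m, n, \<sigma>\<rangle>\<close>, and it is \<open>0\<close> for inadmissible labels.
  Hence the terms with \<open>l - 1/2\<close> in \<open>opa\<close> and \<open>opb\<close> are absent for \<open>l = 0\<close>.\<close>

definition ket :: "real \<Rightarrow> real \<Rightarrow> real \<Rightarrow> spin \<Rightarrow> vec" where
  "ket l m n \<sigma> = (\<lambda>i. if Rep_label i = (l, m, n, \<sigma>) then 1 else 0)"

text \<open>The (anti)linear operator with prescribed values \<open>K l m n \<sigma>\<close> on \<open>|l, m, n, \<sigma>\<rangle>\<close>.\<close>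

definition image_of :: "(real \<Rightarrow> real \<Rightarrow> real \<Rightarrow> spin \<Rightarrow> vec) \<Rightarrow> label \<Rightarrow> vec" where
  "image_of K i = (case Rep_label i of (l, m, n, \<sigma>) \<Rightarrow> K l m n \<sigma>)"

definition lin_ext :: "(real \<Rightarrow> real \<Rightarrow> real \<Rightarrow> spin \<Rightarrow> vec) \<Rightarrow> oper" where
  "lin_ext K v = (\<lambda>j. \<Sum>i | image_of K i j \<noteq> 0. v i * image_of K i j)"

definition antilin_ext :: "(real \<Rightarrow> real \<Rightarrow> real \<Rightarrow> spin \<Rightarrow> vec) \<Rightarrow> oper" where
  "antilin_ext K v = (\<lambda>j. \<Sum>i | image_of K i j \<noteq> 0. cnj (v i) * image_of K i j)"

text \<open>The adjoint of a linear operator: \<open>\<langle>e\<^sub>j, T\<^sup>* v\<rangle> = \<langle>T e\<^sub>j, v\<rangle>\<close>.\<close>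

definition adj :: "oper \<Rightarrow> oper" where
  "adj T v = (\<lambda>j. \<Sum>i | T (unit_vec j) i \<noteq> 0. cnj (T (unit_vec j) i) * v i)"

definition comm :: "oper \<Rightarrow> oper \<Rightarrow> oper" where
  "comm S T = S \<cdot> T - T \<cdot> S"


subsection \<open>The algebra, the Dirac operator and the circle action\<close>

definition lam :: "real \<Rightarrow> real \<Rightarrow> complex" where
  "lam \<theta> x = exp (2 * of_real pi * \<i> * of_real \<theta> * of_real x)"

definition opa :: "real \<Rightarrow> oper" where
  "opa \<theta> = lin_ext (\<lambda>l m n \<sigma>. lam \<theta> (- n) *\<^sub>V
     ((sqrt (l + 1 + m) * sqrt (l + 1 - n) / (sqrt (2 * l + 1) * sqrt (2 * l + 2)))
         *\<^sub>V ket (l + 1/2) (m + 1/2) (n - 1/2) \<sigma>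
      - (sqrt (l - m) * sqrt (l + n) / (sqrt (2 * l) * sqrt (2 * l + 1)))
         *\<^sub>V ket (l - 1/2) (m + 1/2) (n - 1/2) \<sigma>))"

definition opb :: "real \<Rightarrow> oper" where
  "opb \<theta> = lin_ext (\<lambda>l m n \<sigma>. lam \<theta> n *\<^sub>V
     ((sqrt (l + 1 - m) * sqrt (l + 1 - n) / (sqrt (2 * l + 1) * sqrt (2 * l + 2)))
         *\<^sub>V ket (l + 1/2) (m - 1/2) (n - 1/2) \<sigma>
      + (sqrt (l + m) * sqrt (l + n) / (sqrt (2 * l) * sqrt (2 * l + 1)))
         *\<^sub>V ket (l - 1/2) (m - 1/2) (n - 1/2) \<sigma>))"

text \<open>The algebra of the noncommutative 3-sphere, as the unital *-algebra of operators generated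
  by the represented generators.\<close>

inductive_set sphere3 :: "real \<Rightarrow> oper set" for \<theta> :: real where
  "id \<in> sphere3 \<theta>"
| "opa \<theta> \<in> sphere3 \<theta>"
| "opb \<theta> \<in> sphere3 \<theta>"
| "x \<in> sphere3 \<theta> \<Longrightarrow> adj x \<in> sphere3 \<theta>"
| "x \<in> sphere3 \<theta> \<Longrightarrow> c *\<^sub>O x \<in> sphere3 \<theta>"
| "x \<in> sphere3 \<theta> \<Longrightarrow> y \<in> sphere3 \<theta> \<Longrightarrow> x + y \<in> sphere3 \<theta>"
| "x \<in> sphere3 \<theta> \<Longrightarrow> y \<in> sphere3 \<theta> \<Longrightarrow> x \<cdot> y \<in> sphere3 \<theta>"

text \<open>In \<open>Jop\<close>, \<open>cis (pi / 2 * x)\<close> is \<open>\<i>\<^sup>x\<close>; here \<open>x = 2 (m + n)\<close> is an even integer.\<close>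

definition Jop :: oper where
  "Jop = antilin_ext (\<lambda>l m n \<sigma>.
     (of_real (spin_sign \<sigma>) * cis (pi / 2 * (2 * (m + n)))) *\<^sub>V ket l (- m) (- n) (flip \<sigma>))"

definition \<Gamma>op :: oper where
  "\<Gamma>op = lin_ext (\<lambda>l m n \<sigma>. spin_sign \<sigma> *\<^sub>V ket l m n \<sigma>)"

definition \<delta>op :: oper where
  "\<delta>op = lin_ext (\<lambda>l m n \<sigma>. (2 * m + spin_sign \<sigma>) *\<^sub>V ket l m n \<sigma>)"

definition dirac :: "real \<Rightarrow> real \<Rightarrow> complex \<Rightarrow> oper" where
  "dirac r \<alpha> s = lin_ext (\<lambda>l m n \<sigma>. case \<sigma> of
     Plus \<Rightarrow> (r * (m + 1/2) + \<alpha> / 4) *\<^sub>V ket l m n Plus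
        + (s * (sqrt (l + 1 + m) * sqrt (l - m))) *\<^sub>V ket l (m + 1) n Minus
   | Minus \<Rightarrow> (- r * (m - 1/2) + \<alpha> / 4) *\<^sub>V ket l m n Minus
        + (cnj s * (sqrt (l - m + 1) * sqrt (l + m))) *\<^sub>V ket l (m - 1) n Plus)"

text \<open>The definitions below are for a general *-algebra \<open>A\<close> of operators and operator \<open>D\<close> on
  the given Hilbert space. The derivation \<open>\<delta>\<close> of \<open>A\<close> is \<open>comm \<delta>op\<close>.\<close>

definition dirac_hor :: "oper \<Rightarrow> oper" where
  "dirac_hor D = (1/2) *\<^sub>O (\<Gamma>op \<cdot> comm \<Gamma>op D)"

definition dom_hor :: "oper \<Rightarrow> vec set" where
  "dom_hor D = {v \<in> hilb. dirac_hor D v \<in> hilb}"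

definition hilb_deg :: "int \<Rightarrow> vec set" where
  "hilb_deg k = {v \<in> hilb. \<delta>op v = of_int k *\<^sub>V v}"

definition alg_deg :: "oper set \<Rightarrow> int \<Rightarrow> oper set" where
  "alg_deg A k = {x \<in> A. comm \<delta>op x = of_int k *\<^sub>O x}"

abbreviation invariants :: "oper set \<Rightarrow> oper set" where
  "invariants A \<equiv> alg_deg A 0"


subsection \<open>One-forms and strong connections\<close>

abbreviation spanV :: "vec set \<Rightarrow> vec set" where
  "spanV \<equiv> module.span (*\<^sub>V)"

abbreviation spanO :: "oper set \<Rightarrow> oper set" where
  "spanO \<equiv> module.span (*\<^sub>O)"

definition one_forms :: "oper \<Rightarrow> oper set \<Rightarrow> oper set" where
  "one_forms D A = spanO {x' \<cdot> comm D x | x' x. x' \<in> A \<and> x \<in> A}"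

text \<open>The right \<open>A\<close>-module generated by the one-forms of the invariant subalgebra.\<close>

definition hor_forms :: "oper \<Rightarrow> oper set \<Rightarrow> oper set" where
  "hor_forms D A = spanO {\<eta> \<cdot> x | \<eta> x. \<eta> \<in> one_forms D (invariants A) \<and> x \<in> A}"

definition nabla :: "oper \<Rightarrow> oper \<Rightarrow> oper \<Rightarrow> oper" where
  "nabla D \<omega> x = comm D x - comm \<delta>op x \<cdot> \<omega>"

definition vertical_field :: "oper \<Rightarrow> oper set \<Rightarrow> oper \<Rightarrow> bool" where
  "vertical_field D A \<omega> \<longleftrightarrow>
     (\<forall>N p q. (\<forall>i<N. p i \<in> A \<and> q i \<in> A) \<and> \<omega> = (\<Sum>i<N::nat. p i \<cdot> comm D (q i))
        \<longrightarrow> (\<Sum>i<N. p i \<cdot> comm \<delta>op (q i)) = id)"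

definition strong_connection :: "oper \<Rightarrow> oper set \<Rightarrow> oper \<Rightarrow> bool" where
  "strong_connection D A \<omega> \<longleftrightarrow>
     \<omega> \<in> one_forms D A \<and> comm \<delta>op \<omega> = 0 \<and> vertical_field D A \<omega> \<and>
     (\<forall>x\<in>A. nabla D \<omega> x \<in> hor_forms D A)"


subsection \<open>The twisted Dirac operator\<close>

definition right_act :: "vec \<Rightarrow> oper \<Rightarrow> vec" where
  "right_act h x = Jop (adj x (inv Jop h))"

definition right_form :: "vec \<Rightarrow> oper \<Rightarrow> vec" where
  "right_form h \<eta> = - Jop (adj \<eta> (inv Jop h))"

definition twisted_dom :: "oper \<Rightarrow> oper set \<Rightarrow> vec set" where
  "twisted_dom D A =
     spanV {right_act h x | h x k. h \<in> hilb_deg 0 \<inter> dom_hor D \<and> x \<in> alg_deg A k}"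

text \<open>\<open>T\<close> is linear on \<open>twisted_dom D A\<close> and maps \<open>hx\<close> to \<open>(D\<^sub>h h)x + h \<nabla>\<^sub>\<omega>(x)\<close>. The last
  term is \<open>\<Sum>\<^sub>j (h \<eta>\<^sub>j) x\<^sub>j\<close> for \<open>\<nabla>\<^sub>\<omega>(x) = \<Sum>\<^sub>j \<eta>\<^sub>j x\<^sub>j\<close>; the equation is demanded for every such
  decomposition, so the existence of \<open>T\<close> includes the well-definedness of the twisted operator.\<close>

definition is_twisted_dirac :: "oper \<Rightarrow> oper set \<Rightarrow> oper \<Rightarrow> oper \<Rightarrow> bool" where
  "is_twisted_dirac D A \<omega> T \<longleftrightarrow>
     (\<forall>u\<in>twisted_dom D A. \<forall>v\<in>twisted_dom D A. T (u + v) = T u + T v) \<and>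
     (\<forall>c. \<forall>u\<in>twisted_dom D A. T (c *\<^sub>V u) = c *\<^sub>V T u) \<and>
     (\<forall>h k x N \<eta> y.
        h \<in> hilb_deg 0 \<inter> dom_hor D \<and> x \<in> alg_deg A k \<and>
        (\<forall>j<N. \<eta> j \<in> one_forms D (invariants A) \<and> y j \<in> A) \<and>
        nabla D \<omega> x = (\<Sum>j<N::nat. \<eta> j \<cdot> y j)
        \<longrightarrow> T (right_act h x) =
              right_act (dirac_hor D h) x + (\<Sum>j<N. right_act (right_form h (\<eta> j)) (y j)))"

text \<open>Compatibility of \<open>D\<close> with \<open>\<omega>\<close>: the twisted operator is well defined (it is then unique on
  its domain if \<open>\<omega>\<close> is a strong connection) and coincides with the horizontal Dirac operator on
  a dense subset contained in both domains.\<close>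

definition compatible :: "oper \<Rightarrow> oper set \<Rightarrow> oper \<Rightarrow> bool" where
  "compatible D A \<omega> \<longleftrightarrow>
     (\<exists>T. is_twisted_dirac D A \<omega> T) \<and>
     (\<forall>T. is_twisted_dirac D A \<omega> T \<longrightarrow>
        (\<exists>S. dense_in_hilb S \<and> S \<subseteq> twisted_dom D A \<inter> dom_hor D \<and>
             (\<forall>v\<in>S. T v = dirac_hor D v)))"

text \<open>The one-form \<open>\<omega> = a\<^sup>*[D, a] + b[D, b\<^sup>*]\<close>, without the prefactor \<open>r/2\<close> printed in the
  source. As \<open>a\<^sup>* \<delta>(a) + b \<delta>(b\<^sup>*) = a\<^sup>*a + bb\<^sup>* = 1\<close>, the vertical field condition forces the
  prefactor \<open>1\<close>, see \<open>strong_connection_prefactor\<close>; the two expressions agree for \<open>r = 2\<close>.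
  For \<open>D = dirac r \<alpha> s\<close> this one-form is the operator \<open>(r/2) \<Gamma>\<close>.\<close>

definition omega :: "real \<Rightarrow> oper \<Rightarrow> oper" where
  "omega \<theta> D = adj (opa \<theta>) \<cdot> comm D (opa \<theta>) + opb \<theta> \<cdot> comm D (adj (opb \<theta>))"


subsection \<open>The prefactor of the connection form\<close>

definition coef :: "vec \<Rightarrow> real \<times> real \<times> real \<times> spin \<Rightarrow> complex" where
  "coef v t = (\<Sum>i | Rep_label i = t. v i)"

lemma Rep_label_singleton: "{i. Rep_label i = Rep_label j} = {j}"
  by (auto simp: Rep_label_inject)

lemma coef_Rep_label: "Rep_label j = t \<Longrightarrow> coef v t = v j"
  using Rep_label_singleton[of j] by (simp add: coef_def)

lemma finite_Rep_label: "finite {i. Rep_label i = t}"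
  by (rule finite_subset[of _ "{Abs_label t}"]) (auto simp: Rep_label_inverse)

lemma sum_two:
  assumes "\<And>i. M i = (if Rep_label i = t1 then c1 else 0) + (if Rep_label i = t2 then c2 else 0)"
    and "t1 \<noteq> t2"
  shows "(\<Sum>i | M i \<noteq> 0. (v i :: complex) * M i) = c1 * coef v t1 + c2 * coef v t2"
proof -
  let ?S = "{i. Rep_label i = t1} \<union> {i. Rep_label i = t2}"
  have fin: "finite ?S" using finite_Rep_label by blast
  have "(\<Sum>i | M i \<noteq> 0. v i * M i) = (\<Sum>i\<in>?S. v i * M i)"
    by (rule sum.mono_neutral_left) (use fin assms(1) in auto)
  also have "\<dots> = (\<Sum>i\<in>{i. Rep_label i = t1}. v i * M i) + (\<Sum>i\<in>{i. Rep_label i = t2}. v i * M i)"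
    by (rule sum.union_disjoint) (use finite_Rep_label assms(2) in auto)
  also have "(\<Sum>i\<in>{i. Rep_label i = t1}. v i * M i) = c1 * coef v t1"
    unfolding coef_def sum_distrib_left
    by (rule sum.cong) (use assms in auto)
  also have "(\<Sum>i\<in>{i. Rep_label i = t2}. v i * M i) = c2 * coef v t2"
    unfolding coef_def sum_distrib_left
    by (rule sum.cong) (use assms in auto)
  finally show ?thesis .
qed

lemma lin_ext_unit:
  assumes "finite {k. image_of K k i \<noteq> 0}"
  shows "lin_ext K (unit_vec j) i = image_of K j i"
proof -
  have "lin_ext K (unit_vec j) i = (\<Sum>k | image_of K k i \<noteq> 0. if k = j then image_of K j i else 0)"
    unfolding lin_ext_def by (rule sum.cong) (auto simp: unit_vec_def)
  also have "\<dots> = image_of K j i"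
    using assms by (simp add: sum.delta)
  finally show ?thesis .
qed

locale two_term =
  fixes K u d p q 
  assumes K: "\<And>l m n \<sigma>. K l m n \<sigma> = u l m n *\<^sub>V ket (l + 1/2) (m + p) (n + q) \<sigma> +
                d l m n *\<^sub>V ket (l - 1/2) (m + p) (n + q) \<sigma>"
begin

lemma col: "Rep_label k = (l, m, n, \<sigma>) \<Longrightarrow> image_of K k i =
   (if Rep_label i = (l + 1/2, m + p, n + q, \<sigma>) then u l m n else 0) +
   (if Rep_label i = (l - 1/2, m + p, n + q, \<sigma>) then d l m n else 0)"
  by (simp add: image_of_def K ket_def scaleV_def)

lemma row: "Rep_label i = (l, m, n, \<sigma>) \<Longrightarrow> image_of K k i =
   (if Rep_label k = (l - 1/2, m - p, n - q, \<sigma>) then u (l - 1/2) (m - p) (n - q) else 0) +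
   (if Rep_label k = (l + 1/2, m - p, n - q, \<sigma>) then d (l + 1/2) (m - p) (n - q) else 0)"
  by (cases "Rep_label k") (auto simp: col algebra_simps)

lemma val: assumes "Rep_label j = (l, m, n, \<sigma>)"
  shows "lin_ext K v j = u (l - 1/2) (m - p) (n - q) * coef v (l - 1/2, m - p, n - q, \<sigma>) +
            d (l + 1/2) (m - p) (n - q) * coef v (l + 1/2, m - p, n - q, \<sigma>)"
  unfolding lin_ext_def by (rule sum_two[OF row[OF assms]]) simp

lemma fin: "finite {k. image_of K k i \<noteq> 0}"
proof -
  obtain l m n \<sigma> where "Rep_label i = (l, m, n, \<sigma>)" by (cases "Rep_label i")
  then show ?thesis
    by (intro finite_subset[OF _ finite_UnI[OF finite_Rep_label[of "(l - 1/2, m - p, n - q, \<sigma>)"] finite_Rep_label[of "(l + 1/2, m - p, n - q, \<sigma>)"]]])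
      (auto simp: row)
qed

lemma adj_val: assumes "Rep_label j = (l, m, n, \<sigma>)"
  shows "adj (lin_ext K) v j = cnj (u l m n) * coef v (l + 1/2, m + p, n + q, \<sigma>) +
            cnj (d l m n) * coef v (l - 1/2, m + p, n + q, \<sigma>)"
proof -
  have e: "lin_ext K (unit_vec j) i = image_of K j i" for i by (rule lin_ext_unit[OF fin])
  have "adj (lin_ext K) v j = (\<Sum>i | cnj (image_of K j i) \<noteq> 0. v i * cnj (image_of K j i))"
    unfolding adj_def e by (simp add: mult.commute)
  also have "\<dots> = cnj (u l m n) * coef v (l + 1/2, m + p, n + q, \<sigma>) +
            cnj (d l m n) * coef v (l - 1/2, m + p, n + q, \<sigma>)"
    by (rule sum_two) (simp_all add: col[OF assms])
  finally show ?thesis .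
qed

lemma coef_val: "coef (lin_ext K v) (l, m, n, \<sigma>) = (if (l,m,n,\<sigma>) \<in> range Rep_label then
    u (l - 1/2) (m - p) (n - q) * coef v (l - 1/2, m - p, n - q, \<sigma>) +
            d (l + 1/2) (m - p) (n - q) * coef v (l + 1/2, m - p, n - q, \<sigma>) else 0)"
proof (cases "(l,m,n,\<sigma>) \<in> range Rep_label")
  case True
  then obtain j where "Rep_label j = (l,m,n,\<sigma>)" by auto
  then show ?thesis using True by (simp add: coef_Rep_label val)
next
  case False
  then have "{i. Rep_label i = (l,m,n,\<sigma>)} = {}" by (metis (mono_tags, lifting) empty_Collect_eq rangeI)
  then show ?thesis using False by (simp add: coef_def)
qed

lemma coef_adj: "coef (adj (lin_ext K) v) (l, m, n, \<sigma>) = (if (l,m,n,\<sigma>) \<in> range Rep_label then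
    cnj (u l m n) * coef v (l + 1/2, m + p, n + q, \<sigma>) +
            cnj (d l m n) * coef v (l - 1/2, m + p, n + q, \<sigma>) else 0)"
proof (cases "(l,m,n,\<sigma>) \<in> range Rep_label")
  case True
  then obtain j where "Rep_label j = (l,m,n,\<sigma>)" by auto
  then show ?thesis using True by (simp add: coef_Rep_label adj_val)
next
  case False
  then have "{i. Rep_label i = (l,m,n,\<sigma>)} = {}" by (metis (mono_tags, lifting) empty_Collect_eq rangeI)
  then show ?thesis using False by (simp add: coef_def)
qed

end

definition "ua \<theta> l m n = lam \<theta> (- n) * (sqrt (l + 1 + m) * sqrt (l + 1 - n) / (sqrt (2 * l + 1) * sqrt (2 * l + 2)))"
definition "da \<theta> l m n = - lam \<theta> (- n) * (sqrt (l - m) * sqrt (l + n) / (sqrt (2 * l) * sqrt (2 * l + 1)))"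
definition "ub \<theta> l m n = lam \<theta> n * (sqrt (l + 1 - m) * sqrt (l + 1 - n) / (sqrt (2 * l + 1) * sqrt (2 * l + 2)))"
definition "db \<theta> l m n = lam \<theta> n * (sqrt (l + m) * sqrt (l + n) / (sqrt (2 * l) * sqrt (2 * l + 1)))"

abbreviation "Ka \<theta> \<equiv> (\<lambda>l m n \<sigma>. lam \<theta> (- n) *\<^sub>V
     ((sqrt (l + 1 + m) * sqrt (l + 1 - n) / (sqrt (2 * l + 1) * sqrt (2 * l + 2)))
         *\<^sub>V ket (l + 1/2) (m + 1/2) (n - 1/2) \<sigma>
      - (sqrt (l - m) * sqrt (l + n) / (sqrt (2 * l) * sqrt (2 * l + 1)))
         *\<^sub>V ket (l - 1/2) (m + 1/2) (n - 1/2) \<sigma>))"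
abbreviation "Kb \<theta> \<equiv> (\<lambda>l m n \<sigma>. lam \<theta> n *\<^sub>V
     ((sqrt (l + 1 - m) * sqrt (l + 1 - n) / (sqrt (2 * l + 1) * sqrt (2 * l + 2)))
         *\<^sub>V ket (l + 1/2) (m - 1/2) (n - 1/2) \<sigma>
      + (sqrt (l + m) * sqrt (l + n) / (sqrt (2 * l) * sqrt (2 * l + 1)))
         *\<^sub>V ket (l - 1/2) (m - 1/2) (n - 1/2) \<sigma>))"

interpretation genA: two_term "Ka \<theta>" "ua \<theta>" "da \<theta>" "1/2" "-1/2" for \<theta>
  by unfold_locales (auto simp: ua_def da_def scaleV_def fun_eq_iff algebra_simps)
interpretation genB: two_term "Kb \<theta>" "ub \<theta>" "db \<theta>" "-1/2" "-1/2" for \<theta>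
  by unfold_locales (auto simp: ub_def db_def scaleV_def fun_eq_iff algebra_simps)

lemma cnj_lam: "cnj (lam \<theta> x) = lam \<theta> (- x)"
  by (simp add: lam_def exp_cnj)
lemma lam_add: "lam \<theta> x * lam \<theta> y = lam \<theta> (x + y)"
  by (simp add: lam_def exp_add[symmetric] algebra_simps)
lemma lam_0: "lam \<theta> 0 = 1"
  by (simp add: lam_def)

lemma range_Rep_label: "(l,m,n,\<sigma>) \<in> range Rep_label \<longleftrightarrow> 2 * l \<in> \<nat> \<and> l + m \<in> \<nat> \<and> l - m \<in> \<nat> \<and> l + n \<in> \<nat> \<and> l - n \<in> \<nat>"
proof -
  have "range Rep_label = {(l :: real, m :: real, n :: real, \<sigma> :: spin).
      2 * l \<in> \<nat> \<and> l + m \<in> \<nat> \<and> l - m \<in> \<nat> \<and> l + n \<in> \<nat> \<and> l - n \<in> \<nat>}"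
    using type_definition.Rep_range[OF type_definition_label] .
  then show ?thesis by auto
qed


lemma Nats_real_nonneg: "(x::real) \<in> \<nat> \<Longrightarrow> 0 \<le> x" by (auto simp: Nats_def)
lemma Nats_real_pred:
  assumes "(x::real) \<in> \<nat>" "x \<noteq> 0"
  shows "x - 1 \<in> \<nat>"
proof -
  obtain k where "x = of_nat k" using assms(1) by (rule Nats_cases)
  with assms(2) show ?thesis by (cases k) simp_all
qed

lemma Nats_real_Suc: "(x::real) \<in> \<nat> \<Longrightarrow> x + 1 \<in> \<nat>" by (rule Nats_add) auto

lemma Rep_label_conds:
  assumes "Rep_label j = (l, m, n, \<sigma>)"
  shows "2 * l \<in> \<nat> \<and> l + m \<in> \<nat> \<and> l - m \<in> \<nat> \<and> l + n \<in> \<nat> \<and> l - n \<in> \<nat>"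
  using Rep_label[of j] assms by simp

lemma cnj_lam_mult: "cnj (lam \<theta> x) * lam \<theta> x = 1"
  by (simp add: cnj_lam lam_add lam_0)

lemma sqrt_mult_self: "0 \<le> x \<Longrightarrow> sqrt x * sqrt x = x" by simp

lemma opa_opb_coef_mid:
  assumes "0 \<le> l + m" "0 \<le> l - m" "0 \<le> l + n" "0 \<le> l - n" "(0::real) \<le> l"
  shows "cnj (ua \<theta> l m n) * ua \<theta> l m n + cnj (da \<theta> l m n) * da \<theta> l m n
    + ub \<theta> (l - 1/2) (m + 1/2) (n + 1/2) * cnj (ub \<theta> (l - 1/2) (m + 1/2) (n + 1/2))
    + db \<theta> (l + 1/2) (m + 1/2) (n + 1/2) * cnj (db \<theta> (l + 1/2) (m + 1/2) (n + 1/2)) = 1"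
proof -
  have sc: "cnj (lam \<theta> x * complex_of_real y) * (lam \<theta> x * complex_of_real y) = complex_of_real (y * y)" for x y
    using cnj_lam_mult[of \<theta> x] by (simp add: algebra_simps)
  have q: "sqrt a * sqrt b / (sqrt c * sqrt d) * (sqrt a * sqrt b / (sqrt c * sqrt d)) = a * b / (c * d)"
    if "0 \<le> a" "0 \<le> b" "0 \<le> c" "0 \<le> d" for a b c d
    using that by (simp add: sqrt_mult_self real_sqrt_mult[symmetric] real_sqrt_divide[symmetric])
  have a1: "cnj (ua \<theta> l m n) * ua \<theta> l m n = complex_of_real ((l + 1 + m) * (l + 1 - n) / ((2 * l + 1) * (2 * l + 2)))"
    unfolding ua_def sc by (subst q) (use assms in auto)
  have a2: "cnj (da \<theta> l m n) * da \<theta> l m n = complex_of_real ((l - m) * (l + n) / ((2 * l) * (2 * l + 1)))"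
    unfolding da_def complex_cnj_minus mult_minus_left mult_minus_right minus_minus sc by (subst q) (use assms in auto)
  have a3: "ub \<theta> (l - 1/2) (m + 1/2) (n + 1/2) * cnj (ub \<theta> (l - 1/2) (m + 1/2) (n + 1/2))
     = complex_of_real ((l - m) * (l - n) / ((2 * l) * (2 * l + 1)))"
    unfolding ub_def mult.commute[of _ "cnj _"] sc by (subst q) (use assms in \<open>auto simp: algebra_simps\<close>)
  have a4: "db \<theta> (l + 1/2) (m + 1/2) (n + 1/2) * cnj (db \<theta> (l + 1/2) (m + 1/2) (n + 1/2))
     = complex_of_real ((l + 1 + m) * (l + 1 + n) / ((2 * l + 1) * (2 * l + 2)))"
    unfolding db_def mult.commute[of _ "cnj _"] sc by (subst q) (use assms in \<open>auto simp: algebra_simps\<close>)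
  have "(l + 1 + m) * (l + 1 - n) / ((2 * l + 1) * (2 * l + 2)) + (l - m) * (l + n) / ((2 * l) * (2 * l + 1))
     + (l - m) * (l - n) / ((2 * l) * (2 * l + 1)) + (l + 1 + m) * (l + 1 + n) / ((2 * l + 1) * (2 * l + 2)) = 1"
  proof (cases "l = 0")
    case True then show ?thesis using assms by auto
  next
    case False
    have s1: "(l + 1 + m) * (l + 1 - n) / ((2 * l + 1) * (2 * l + 2)) + (l + 1 + m) * (l + 1 + n) / ((2 * l + 1) * (2 * l + 2))
      = (l + 1 + m) / (2 * l + 1)"
      using assms by (simp add: divide_simps) (simp add: algebra_simps)
    have s2: "(l - m) * (l + n) / ((2 * l) * (2 * l + 1)) + (l - m) * (l - n) / ((2 * l) * (2 * l + 1)) = (l - m) / (2 * l + 1)"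
      using assms False by (simp add: divide_simps) (simp add: algebra_simps)
    have "(l + 1 + m) / (2 * l + 1) + (l - m) / (2 * l + 1) = 1" using assms by (simp add: divide_simps)
    then show ?thesis using s1 s2 by linarith
  qed
  then show ?thesis unfolding a1 a2 a3 a4 of_real_add[symmetric] by simp
qed

lemma opa_opb_coef_up:
  shows "cnj (ua \<theta> l m n) * da \<theta> (l + 1) m n
    + db \<theta> (l + 1/2) (m + 1/2) (n + 1/2) * cnj (ub \<theta> (l + 1/2) (m + 1/2) (n + 1/2)) = 0"
proof -
  have "cnj (ua \<theta> l m n) * da \<theta> (l + 1) m n = - complex_of_real (sqrt (l + 1 + m) * sqrt (l + 1 - n) / (sqrt (2 * l + 1) * sqrt (2 * l + 2)) * (sqrt (l + 1 - m) * sqrt (l + 1 + n) / (sqrt (2 * l + 2) * sqrt (2 * l + 3))))"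
    using cnj_lam_mult[of \<theta> "- n"] by (simp add: ua_def da_def algebra_simps)
  moreover have "db \<theta> (l + 1/2) (m + 1/2) (n + 1/2) * cnj (ub \<theta> (l + 1/2) (m + 1/2) (n + 1/2)) = 
    complex_of_real (sqrt (l + 1 + m) * sqrt (l + 1 - n) / (sqrt (2 * l + 1) * sqrt (2 * l + 2)) * (sqrt (l + 1 - m) * sqrt (l + 1 + n) / (sqrt (2 * l + 2) * sqrt (2 * l + 3))))"
    using cnj_lam_mult[of \<theta> "n + 1/2"] by (simp add: ub_def db_def algebra_simps)
  ultimately show ?thesis by simp
qed

lemma opa_opb_coef_down:
  shows "cnj (da \<theta> l m n) * ua \<theta> (l - 1) m n
    + ub \<theta> (l - 1/2) (m + 1/2) (n + 1/2) * cnj (db \<theta> (l - 1/2) (m + 1/2) (n + 1/2)) = 0"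
  using arg_cong[OF opa_opb_coef_up[of \<theta> "l - 1" m n], of cnj] by (simp add: algebra_simps)

lemma opa_opb_unit_relation: "adj (opa \<theta>) \<cdot> opa \<theta> + opb \<theta> \<cdot> adj (opb \<theta>) = id"
proof (intro ext)
  fix v j
  obtain l m n \<sigma> where j: "Rep_label j = (l, m, n, \<sigma>)" by (cases "Rep_label j")
  note R = Rep_label_conds[OF j]
  have pos: "0 \<le> l + m" "0 \<le> l - m" "0 \<le> l + n" "0 \<le> l - n" "0 \<le> l" using R Nats_real_nonneg by (auto dest: Nats_real_nonneg)
  define V where "V = coef v (l,m,n,\<sigma>)"
  have vj: "v j = V" using coef_Rep_label[OF j] by (simp add: V_def)
  define W where "W = coef v (l + 1,m,n,\<sigma>)"
  define U where "U = coef v (l - 1,m,n,\<sigma>)"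
  have e: "l + m + 1 \<in> \<nat>" "l - m + 1 \<in> \<nat>" "l + n + 1 \<in> \<nat>" "l - n + 1 \<in> \<nat>" "2 * l + 1 \<in> \<nat>" using R by (auto intro: Nats_real_Suc)
  have 1: "(l + 1/2, m + 1/2, n - 1/2, \<sigma>) \<in> range Rep_label" "(l + 1/2, m + 1/2, n + 1/2, \<sigma>) \<in> range Rep_label"
    using R e unfolding range_Rep_label by (auto simp: algebra_simps)
  have X1: "coef (opa \<theta> v) (l + 1/2, m + 1/2, n - 1/2, \<sigma>) = ua \<theta> l m n * V + da \<theta> (l + 1) m n * W"
    using 1 unfolding opa_def genA.coef_val by (simp add: V_def W_def algebra_simps)
  have Y2: "coef (adj (opb \<theta>) v) (l + 1/2, m + 1/2, n + 1/2, \<sigma>) = 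
    cnj (ub \<theta> (l + 1/2) (m + 1/2) (n + 1/2)) * W + cnj (db \<theta> (l + 1/2) (m + 1/2) (n + 1/2)) * V"
    using 1 unfolding opb_def genB.coef_adj by (simp add: V_def W_def algebra_simps)
  have X2: "cnj (da \<theta> l m n) * coef (opa \<theta> v) (l - 1/2, m + 1/2, n - 1/2, \<sigma>) = cnj (da \<theta> l m n) * (ua \<theta> (l - 1) m n * U + da \<theta> l m n * V)"
  proof (cases "da \<theta> l m n = 0")
    case False
    then have "l - m \<noteq> 0" "l + n \<noteq> 0" by (auto simp: da_def)
    with R have "l - m - 1 \<in> \<nat>" "l + n - 1 \<in> \<nat>" by (auto intro: Nats_real_pred)
    moreover from this have "2 * l - 1 \<in> \<nat>" using R Nats_add[of "l - m - 1" "l + m"] by (simp add: algebra_simps)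
    ultimately have "(l - 1/2, m + 1/2, n - 1/2, \<sigma>) \<in> range Rep_label" using R unfolding range_Rep_label by (simp add: algebra_simps)
    then show ?thesis unfolding opa_def genA.coef_val by (simp add: V_def U_def algebra_simps)
  qed simp
  have Y1: "ub \<theta> (l - 1/2) (m + 1/2) (n + 1/2) * coef (adj (opb \<theta>) v) (l - 1/2, m + 1/2, n + 1/2, \<sigma>) =
    ub \<theta> (l - 1/2) (m + 1/2) (n + 1/2) * (cnj (ub \<theta> (l - 1/2) (m + 1/2) (n + 1/2)) * V + cnj (db \<theta> (l - 1/2) (m + 1/2) (n + 1/2)) * U)"
  proof (cases "ub \<theta> (l - 1/2) (m + 1/2) (n + 1/2) = 0")
    case False
    then have "l - m \<noteq> 0" "l - n \<noteq> 0" by (auto simp: ub_def)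
    with R have "l - m - 1 \<in> \<nat>" "l - n - 1 \<in> \<nat>" by (auto intro: Nats_real_pred)
    moreover from this have "2 * l - 1 \<in> \<nat>" using R Nats_add[of "l - m - 1" "l + m"] by (simp add: algebra_simps)
    ultimately have "(l - 1/2, m + 1/2, n + 1/2, \<sigma>) \<in> range Rep_label" using R unfolding range_Rep_label by (simp add: algebra_simps)
    then show ?thesis unfolding opb_def genB.coef_adj by (simp add: V_def U_def algebra_simps)
  qed simp
  have "(adj (opa \<theta>) \<cdot> opa \<theta> + opb \<theta> \<cdot> adj (opb \<theta>)) v j = 
     cnj (ua \<theta> l m n) * coef (opa \<theta> v) (l + 1/2, m + 1/2, n - 1/2, \<sigma>) + cnj (da \<theta> l m n) * coef (opa \<theta> v) (l - 1/2, m + 1/2, n - 1/2, \<sigma>)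
     + (ub \<theta> (l - 1/2) (m + 1/2) (n + 1/2) * coef (adj (opb \<theta>) v) (l - 1/2, m + 1/2, n + 1/2, \<sigma>) +
       db \<theta> (l + 1/2) (m + 1/2) (n + 1/2) * coef (adj (opb \<theta>) v) (l + 1/2, m + 1/2, n + 1/2, \<sigma>))"
    by (simp add: genA.adj_val[OF j, folded opa_def] genB.val[OF j, folded opb_def])
  also have "\<dots> = (cnj (ua \<theta> l m n) * ua \<theta> l m n + cnj (da \<theta> l m n) * da \<theta> l m n
    + ub \<theta> (l - 1/2) (m + 1/2) (n + 1/2) * cnj (ub \<theta> (l - 1/2) (m + 1/2) (n + 1/2))
    + db \<theta> (l + 1/2) (m + 1/2) (n + 1/2) * cnj (db \<theta> (l + 1/2) (m + 1/2) (n + 1/2))) * V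
    + (cnj (ua \<theta> l m n) * da \<theta> (l + 1) m n
    + db \<theta> (l + 1/2) (m + 1/2) (n + 1/2) * cnj (ub \<theta> (l + 1/2) (m + 1/2) (n + 1/2))) * W
    + (cnj (da \<theta> l m n) * ua \<theta> (l - 1) m n
    + ub \<theta> (l - 1/2) (m + 1/2) (n + 1/2) * cnj (db \<theta> (l - 1/2) (m + 1/2) (n + 1/2))) * U"
    unfolding X1 X2 Y1 Y2 by (simp only: algebra_simps)
  also have "\<dots> = id v j" unfolding opa_opb_coef_mid[OF pos] opa_opb_coef_up opa_opb_coef_down by (simp add: vj)
  finally show "(adj (opa \<theta>) \<cdot> opa \<theta> + opb \<theta> \<cdot> adj (opb \<theta>)) v j = id v j" .
qed

lemma delta_apply: assumes j: "Rep_label j = (l, m, n, \<sigma>)" shows "\<delta>op v j = complex_of_real (2 * m + spin_sign \<sigma>) * v j"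
proof -
  have "image_of (\<lambda>l m n \<sigma>. (2 * m + spin_sign \<sigma>) *\<^sub>V ket l m n \<sigma>) i j
     = (if Rep_label i = (l, m, n, \<sigma>) then complex_of_real (2 * m + spin_sign \<sigma>) else 0) + (if Rep_label i = (l + 1, m, n, \<sigma>) then 0 else 0)" for i
    by (cases "Rep_label i") (auto simp: image_of_def ket_def scaleV_def j)
  from sum_two[OF this, of v] coef_Rep_label[OF j, of v] show ?thesis by (simp add: \<delta>op_def lin_ext_def)
qed

lemma coef_delta: "coef (\<delta>op v) (l, m, n, \<sigma>) = (2 * m + spin_sign \<sigma>) * coef v (l, m, n, \<sigma>)"
  unfolding coef_def sum_distrib_left by (rule sum.cong) (auto simp: delta_apply[of _ l m n \<sigma>])

lemma delta_opa: "comm \<delta>op (opa \<theta>) = opa \<theta>"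
proof (intro ext)
  fix v j
  obtain l m n \<sigma> where j: "Rep_label j = (l, m, n, \<sigma>)" by (cases "Rep_label j")
  show "comm \<delta>op (opa \<theta>) v j = opa \<theta> v j"
    by (simp add: comm_def delta_apply[OF j] genA.val[OF j, folded opa_def] coef_delta) (simp add: algebra_simps)
qed

lemma delta_adj_opb: "comm \<delta>op (adj (opb \<theta>)) = adj (opb \<theta>)"
proof (intro ext)
  fix v j
  obtain l m n \<sigma> where j: "Rep_label j = (l, m, n, \<sigma>)" by (cases "Rep_label j")
  show "comm \<delta>op (adj (opb \<theta>)) v j = adj (opb \<theta>) v j"
    by (simp add: comm_def delta_apply[OF j] genB.adj_val[OF j, folded opb_def] coef_delta) (simp add: algebra_simps)
qed

lemma strong_connection_prefactor:
  assumes "strong_connection D (sphere3 \<theta>) (c *\<^sub>O omega \<theta> D)"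
  shows "c = 1"
proof -
  let ?p = "\<lambda>i::nat. if i = 0 then c *\<^sub>O adj (opa \<theta>) else c *\<^sub>O opb \<theta>"
  let ?q = "\<lambda>i::nat. if i = 0 then opa \<theta> else adj (opb \<theta>)"
  have m: "\<forall>i<2. ?p i \<in> sphere3 \<theta> \<and> ?q i \<in> sphere3 \<theta>" by (auto intro: sphere3.intros)
  have "c *\<^sub>O omega \<theta> D = (\<Sum>i<2. ?p i \<cdot> comm D (?q i))"
    by (auto simp: numeral_2_eq_2 omega_def scaleO_def scaleV_def fun_eq_iff algebra_simps)
  with m have "(\<forall>i<2. ?p i \<in> sphere3 \<theta> \<and> ?q i \<in> sphere3 \<theta>) \<and> c *\<^sub>O omega \<theta> D = (\<Sum>i<2. ?p i \<cdot> comm D (?q i))"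
    by (rule conjI)
  note pq = this
  have "vertical_field D (sphere3 \<theta>) (c *\<^sub>O omega \<theta> D)"
    using assms unfolding strong_connection_def by (elim conjE)
  from this[unfolded vertical_field_def, THEN spec[of _ 2], THEN spec[of _ ?p], THEN spec[of _ ?q], THEN mp, OF pq]
  have "(\<Sum>i<2. ?p i \<cdot> comm \<delta>op (?q i)) = id" .
  then have "c *\<^sub>O (adj (opa \<theta>) \<cdot> opa \<theta> + opb \<theta> \<cdot> adj (opb \<theta>)) = id"
    by (auto simp: numeral_2_eq_2 delta_opa delta_adj_opb scaleO_def scaleV_def fun_eq_iff algebra_simps)
  then have "(c *\<^sub>O id) (\<lambda>_. 1) = id (\<lambda>_::label. (1::complex))" unfolding opa_opb_unit_relation by simp
  then show ?thesis by (simp add: scaleO_def scaleV_def fun_eq_iff)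
qed

end

theory Submission
  imports Defs
begin

text \<open>
  Write \<open>A\<close> for the algebra, \<open>B\<close> for its invariant part, \<open>D\<close> for the Dirac operator and \<open>H\<close> for its
  horizontal part. Then \<open>D = H + (r/2) \<Gamma> \<delta> + \<alpha>/4\<close> (\<open>dirac_eq\<close>), where \<open>\<Gamma>\<close> commutes with \<open>A\<close> and
  anticommutes with \<open>H\<close>. Hence \<open>[D, x] = [H, x] + (r/2) \<Gamma> \<delta>(x)\<close>, and as soon as \<open>\<omega> = (r/2) \<Gamma>\<close> is known, the
  covariant derivative is simply \<open>\<nabla>(x) = [H, x]\<close> (\<open>nabla_eq\<close>).

  Everything rests on two partitions of unity which are flat for \<open>H\<close>. Let \<open>u = (a\<^sup>*, b)\<close> and
  \<open>v = (a, b\<^sup>*)\<close>, or \<open>u = (a, b\<^sup>*)\<close> and \<open>v = (a\<^sup>*, b)\<close>. In both cases \<open>\<Sum> u\<^sub>i v\<^sub>i = 1\<close> and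
  \<open>\<Sum> u\<^sub>i [H, v\<^sub>i] = 0\<close>, and \<open>v\<close> has degree \<open>1\<close>, respectively \<open>-1\<close> (\<open>flat_partition\<close>). The reason is that \<open>H\<close>
  is built from the operators \<open>L\<^sub>+\<close> and \<open>L\<^sub>-\<close> which raise and lower \<open>m\<close>, and that \<open>(a, b)\<close> is a
  doublet for these: \<open>[L\<^sub>+, a] = 0 = [L\<^sub>-, b]\<close>, while \<open>[L\<^sub>-, a]\<close> and \<open>[L\<^sub>+, b]\<close> are \<open>b\<close> and \<open>a\<close> with the twist \<open>\<lambda>\<close>
  inverted. Differentiating \<open>\<Sum> u\<^sub>i v\<^sub>i = 1\<close>, either all \<open>[L, v\<^sub>i]\<close> vanish or all \<open>[L, u\<^sub>i]\<close> vanish, and in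
  both cases \<open>\<Sum> u\<^sub>i [L, v\<^sub>i] = 0\<close>. The relation \<open>a a\<^sup>* + b\<^sup>* b = 1\<close> itself follows from
  \<open>a\<^sup>* a + b b\<^sup>* = 1\<close> by differentiating twice.

  Flatness of the first partition gives \<open>\<omega> = (r/2) \<Gamma> \<Sum> u\<^sub>i v\<^sub>i = (r/2) \<Gamma>\<close> (\<open>omega_eq\<close>). The vertical field
  condition holds because \<open>\<Gamma> D + D \<Gamma>\<close> is \<open>r \<delta>\<close> up to a multiple of \<open>\<Gamma>\<close>: the map \<open>z \<mapsto> \<Gamma> z + z \<Gamma>\<close> sends \<open>p [D, q]\<close> to
  \<open>r p \<delta>(q)\<close>, and it sends \<open>\<omega>\<close> to \<open>r\<close>. For the remaining condition let \<open>x\<close> be homogeneous of degree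
  \<open>k \<noteq> 0\<close> and take the partition whose \<open>u\<close> moves \<open>k\<close> towards \<open>0\<close>. Then \<open>[H, x] = \<Sum> [H, x u\<^sub>i] v\<^sub>i\<close> by flatness, and
  induction on \<open>|k|\<close> ends in degree \<open>0\<close>, where \<open>[H, x] = [D, x]\<close> is a one-form over \<open>B\<close>
  (\<open>hor_form_homogeneous\<close>).

  As \<open>H\<close> is symmetric and commutes with \<open>J\<close>, the prescription for the twisted operator reads
  \<open>h x \<mapsto> H (h x)\<close>, whatever decomposition of \<open>\<nabla>(x)\<close> is used (\<open>hor_right_act\<close>). So \<open>H\<close> is a twisted operator, and the only
  one on the twisted domain. It remains to see that this domain is dense. The partitions apply
  once more: a finitely supported \<open>h\<close> of degree \<open>k \<noteq> 0\<close> is \<open>\<Sum> (h u\<^sub>i) v\<^sub>i\<close>, and induction on \<open>|k|\<close>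
  places every vector of finite support in the domain (\<open>finsupp_twisted_dom\<close>).
\<close>

section \<open>Operators with finite rows and columns\<close>

lemmas pointwise = plus_fun_apply zero_fun_apply minus_apply uminus_apply

text \<open>As rewrite rules, these equations would expand a vector \<open>u + v\<close> to \<open>\<lambda>i. u i + v i\<close> in the
  argument of an operator.\<close>

declare pointwise [simp del]

lemma oper_apply [simp]:
  fixes S T :: oper
  shows "(S + T) v = S v + T v" "(S - T) v = S v - T v" "(- S) v = - S v"
    "(0 :: oper) v = 0" "(c *\<^sub>O T) v = c *\<^sub>V T v"
  by (auto simp: pointwise scaleO_def)

interpretation V: vector_space "(*\<^sub>V)"
  by unfold_locales (auto simp: pointwise scaleV_def fun_eq_iff algebra_simps)

interpretation O: vector_space "(*\<^sub>O)"
  by unfold_locales (auto simp: scaleO_def pointwise scaleV_def fun_eq_iff algebra_simps)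

interpretation VV: vector_space_pair "(*\<^sub>V)" "(*\<^sub>V)" ..

abbreviation linear_oper :: "oper \<Rightarrow> bool" where
  "linear_oper \<equiv> Vector_Spaces.linear (*\<^sub>V) (*\<^sub>V)"

lemma linear_operI:
  assumes "\<And>u v. T (u + v) = T u + T v" "\<And>c v. T (c *\<^sub>V v) = c *\<^sub>V T v"
  shows "linear_oper T"
  using assms by unfold_locales auto

lemma sum_fun_apply: "(\<Sum>i\<in>A. f i) x = (\<Sum>i\<in>A. f i x :: 'b :: comm_monoid_add)"
  by (induction A rule: infinite_finite_induct) (auto simp: pointwise)

lemma scaleV_apply: "(c *\<^sub>V v) i = c * v i"
  by (simp add: scaleV_def)

definition finsupp :: "vec set" where
  "finsupp = {v. finite {i. v i \<noteq> 0}}"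

lemma finsupp_subspace: "V.subspace finsupp"
proof (rule V.subspaceI)
  fix u v :: vec assume "u \<in> finsupp" "v \<in> finsupp"
  moreover have "{i. (u + v) i \<noteq> 0} \<subseteq> {i. u i \<noteq> 0} \<union> {i. v i \<noteq> 0}" by (auto simp: pointwise)
  ultimately show "u + v \<in> finsupp"
    unfolding finsupp_def by (simp add: finite_subset)
next
  fix c and u :: vec assume "u \<in> finsupp"
  moreover have "{i. (c *\<^sub>V u) i \<noteq> 0} \<subseteq> {i. u i \<noteq> 0}" by (auto simp: scaleV_apply)
  ultimately show "c *\<^sub>V u \<in> finsupp"
    unfolding finsupp_def by (simp add: finite_subset)
qed (simp add: finsupp_def pointwise)

lemma unit_vec_finsupp: "unit_vec j \<in> finsupp"
  unfolding finsupp_def unit_vec_def by simp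

lemma finsupp_eq_span: "finsupp = V.span (range unit_vec)"
proof (rule antisym)
  show "V.span (range unit_vec) \<subseteq> finsupp"
    using unit_vec_finsupp by (intro V.span_minimal finsupp_subspace) auto
  show "finsupp \<subseteq> V.span (range unit_vec)"
  proof
    fix v :: vec assume v: "v \<in> finsupp"
    have "v = (\<Sum>j | v j \<noteq> 0. v j *\<^sub>V unit_vec j)"
      using v by (auto simp: pointwise fun_eq_iff sum_fun_apply scaleV_apply unit_vec_def finsupp_def pointwise
          if_distrib[of "\<lambda>x. _ * x"] cong: if_cong)
    then show "v \<in> V.span (range unit_vec)"
      using V.span_sum[of "{j. v j \<noteq> 0}" "\<lambda>j. v j *\<^sub>V unit_vec j" "range unit_vec"]
      by (metis V.span_base V.span_scale rangeI)
  qed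
qed

text \<open>The class of operators for which \<open>adj\<close> behaves like an adjoint: it is closed under sums,
  compositions and \<open>adj\<close>, and on it \<open>adj\<close> reverses products. Finite rows are what makes the columns of an adjoint
  finite.\<close>

definition locally_finite :: "oper \<Rightarrow> bool" where
  "locally_finite T \<longleftrightarrow> linear_oper T \<and> (\<forall>j. T (unit_vec j) \<in> finsupp) \<and>
     (\<forall>i. finite {j. T (unit_vec j) i \<noteq> 0})"

lemma lf_linear: "locally_finite T \<Longrightarrow> linear_oper T"
  by (simp add: locally_finite_def)

lemma finsupp_induct [consumes 1, case_names zero step]:
  assumes "v \<in> finsupp" "P 0"
    "\<And>c j y. y \<in> finsupp \<Longrightarrow> P y \<Longrightarrow> P (c *\<^sub>V unit_vec j + y)"
  shows "P v"
proof -
  from assms(1) have "v \<in> finsupp \<and> P v"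
    unfolding finsupp_eq_span
  proof (induction rule: V.span_induct_alt)
    case (step c x y)
    then show ?case
      using assms(3)[of y c] by (auto simp: finsupp_eq_span intro: V.span_add V.span_scale V.span_base)
  qed (use assms(2) V.span_zero in auto)
  then show ?thesis by simp
qed

lemma lf_finsupp:
  assumes "locally_finite T" "v \<in> finsupp"
  shows "T v \<in> finsupp"
  using assms(2)
proof (induction rule: finsupp_induct)
  case zero
  then show ?case
    using VV.linear_0[OF lf_linear[OF assms(1)]] V.subspace_0[OF finsupp_subspace] by metis
next
  case (step c j y)
  have "T (unit_vec j) \<in> finsupp" using assms(1) by (auto simp: locally_finite_def)
  then have "c *\<^sub>V T (unit_vec j) + T y \<in> finsupp"
    using step(2) finsupp_subspace by (intro V.subspace_add V.subspace_scale)
  then show ?case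
    unfolding VV.linear_add[OF lf_linear[OF assms(1)]] VV.linear_scale[OF lf_linear[OF assms(1)]] .
qed

text \<open>The inner product, extended to pairs of families of which only the first has to have
  finite support.\<close>

definition pairing :: "vec \<Rightarrow> vec \<Rightarrow> complex" where
  "pairing u v = (\<Sum>i | u i \<noteq> 0. cnj (u i) * v i)"

lemma pairing_superset:
  assumes "finite F" "{i. u i \<noteq> 0} \<subseteq> F"
  shows "pairing u v = (\<Sum>i\<in>F. cnj (u i) * v i)"
  unfolding pairing_def by (rule sum.mono_neutral_left) (use assms in auto)

lemma pairing_add_left:
  assumes "u \<in> finsupp" "w \<in> finsupp"
  shows "pairing (u + w) v = pairing u v + pairing w v"
proof -
  let ?F = "{i. u i \<noteq> 0} \<union> {i. w i \<noteq> 0}"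
  have F: "finite ?F" using assms by (simp add: finsupp_def)
  have "pairing (u + w) v = (\<Sum>i\<in>?F. cnj ((u + w) i) * v i)"
    by (rule pairing_superset[OF F]) (auto simp: pointwise)
  also have "\<dots> = (\<Sum>i\<in>?F. cnj (u i) * v i) + (\<Sum>i\<in>?F. cnj (w i) * v i)"
    by (simp add: sum.distrib pointwise algebra_simps)
  also have "\<dots> = pairing u v + pairing w v"
    using pairing_superset[OF F, of u v] pairing_superset[OF F, of w v] by auto
  finally show ?thesis .
qed

lemma pairing_scale_left: "pairing (c *\<^sub>V u) v = cnj c * pairing u v"
  by (cases "c = 0") (auto simp: pairing_def scaleV_apply pointwise sum_distrib_left mult.assoc intro!: sum.cong)

lemma pairing_add_right: "pairing u (v + w) = pairing u v + pairing u w"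
  by (simp add: pairing_def sum.distrib pointwise algebra_simps)

lemma pairing_scale_right: "pairing u (c *\<^sub>V v) = c * pairing u v"
  by (simp add: pairing_def scaleV_apply sum_distrib_left algebra_simps)

lemma pairing_unit: "pairing (unit_vec j) v = v j"
  by (subst pairing_superset[of "{j}"]) (auto simp: unit_vec_def)

lemma adj_eq_pairing: "adj T v j = pairing (T (unit_vec j)) v"
  by (simp add: adj_def pairing_def)

lemma adj_linear: "linear_oper (adj T)"
  by (rule linear_operI) (auto simp: adj_eq_pairing pairing_add_right pairing_scale_right
      scaleV_apply pointwise fun_eq_iff)

text \<open>By definition of \<open>adj\<close> this holds for unit vectors; it extends along finite sums.\<close>

lemma pairing_adj:
  assumes "locally_finite T" "u \<in> finsupp"
  shows "pairing (T u) v = pairing u (adj T v)"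
  using assms(2)
proof (induction rule: finsupp_induct)
  case zero
  have "pairing 0 w = 0" for w by (simp add: pairing_def pointwise)
  then show ?case using VV.linear_0[OF lf_linear[OF assms(1)]] by metis
next
  case (step c j y)
  have "pairing (T (c *\<^sub>V unit_vec j + y)) v = cnj c * pairing (T (unit_vec j)) v + pairing (T y) v"
    unfolding VV.linear_add[OF lf_linear[OF assms(1)]] VV.linear_scale[OF lf_linear[OF assms(1)]]
    using step(1) unit_vec_finsupp lf_finsupp[OF assms(1)] finsupp_subspace
    by (simp add: pairing_add_left pairing_scale_left V.subspace_scale)
  also have "\<dots> = pairing (c *\<^sub>V unit_vec j + y) (adj T v)"
    using step unit_vec_finsupp finsupp_subspace
    by (simp add: pairing_add_left pairing_scale_left V.subspace_scale pairing_unit)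
      (simp add: adj_eq_pairing)
  finally show ?case .
qed

lemma adj_unit_vec:
  assumes "locally_finite T"
  shows "adj T (unit_vec j) i = cnj (T (unit_vec i) j)"
proof -
  have "adj T (unit_vec j) i = (\<Sum>k | T (unit_vec i) k \<noteq> 0. cnj (T (unit_vec i) k) * (if k = j then 1 else 0))"
    by (simp add: adj_def unit_vec_def)
  also have "\<dots> = cnj (T (unit_vec i) j)"
    using assms by (subst if_distrib) (auto simp: locally_finite_def finsupp_def sum.delta cong: if_cong)
  finally show ?thesis .
qed

lemma lf_adj: assumes "locally_finite T" shows "locally_finite (adj T)"
  using assms adj_linear unfolding locally_finite_def finsupp_def pointwise
  by (auto simp: adj_unit_vec[OF assms])

lemma lf_id: "locally_finite id"
  unfolding locally_finite_def using unit_vec_finsupp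
  by (auto simp: unit_vec_def intro!: linear_operI)

lemma lf_zero: "locally_finite 0"
  unfolding locally_finite_def using finsupp_subspace
  by (auto simp: pointwise intro!: linear_operI V.subspace_0)

lemma lf_add:
  assumes "locally_finite S" "locally_finite T"
  shows "locally_finite (S + T)"
  unfolding locally_finite_def
proof (intro conjI allI)
  show "linear_oper (S + T)"
    using VV.linear_compose_add[OF assms[THEN lf_linear]] by (simp add: plus_fun_def)
  show "(S + T) (unit_vec j) \<in> finsupp" for j
    using assms finsupp_subspace by (auto simp: locally_finite_def intro: V.subspace_add)
  fix i
  have "{j. (S + T) (unit_vec j) i \<noteq> 0} \<subseteq> {j. S (unit_vec j) i \<noteq> 0} \<union> {j. T (unit_vec j) i \<noteq> 0}"
    by (auto simp: pointwise)
  then show "finite {j. (S + T) (unit_vec j) i \<noteq> 0}"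
    using assms by (auto simp: locally_finite_def intro: finite_subset)
qed

lemma lf_scale:
  assumes "locally_finite T"
  shows "locally_finite (c *\<^sub>O T)"
  unfolding locally_finite_def
proof (intro conjI allI)
  show "linear_oper (c *\<^sub>O T)"
    by (intro linear_operI) (simp_all add:  V.scale_right_distrib mult.commute
        VV.linear_add[OF lf_linear[OF assms]] VV.linear_scale[OF lf_linear[OF assms]])
  show "(c *\<^sub>O T) (unit_vec j) \<in> finsupp" for j
    using assms finsupp_subspace by (auto simp: locally_finite_def  intro: V.subspace_scale)
  fix i
  have "{j. (c *\<^sub>O T) (unit_vec j) i \<noteq> 0} \<subseteq> {j. T (unit_vec j) i \<noteq> 0}"
    by (auto simp:  scaleV_apply)
  then show "finite {j. (c *\<^sub>O T) (unit_vec j) i \<noteq> 0}"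
    using assms by (auto simp: locally_finite_def intro: finite_subset)
qed

lemma lf_diff:
  assumes "locally_finite S" "locally_finite T"
  shows "locally_finite (S - T)"
proof -
  have "S - T = S + (-1) *\<^sub>O T" by simp
  then show ?thesis using lf_add[OF assms(1) lf_scale[OF assms(2), of "-1"]] by simp
qed

lemma lf_comp:
  assumes "locally_finite S" "locally_finite T"
  shows "locally_finite (S \<cdot> T)"
  unfolding locally_finite_def
proof (intro conjI allI)
  show "linear_oper (S \<cdot> T)"
    using Vector_Spaces.linear_compose[OF lf_linear[OF assms(2)] lf_linear[OF assms(1)]] .
  show "(S \<cdot> T) (unit_vec j) \<in> finsupp" for j
    using lf_finsupp[OF assms(1) lf_finsupp[OF assms(2) unit_vec_finsupp]] by simp
  fix i
  let ?R = "{j. adj S (unit_vec i) j \<noteq> 0}"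
  have "finite ?R"
    using lf_adj[OF assms(1)] by (simp add: locally_finite_def finsupp_def)
  moreover have "finite {k. T (unit_vec k) j \<noteq> 0}" for j
    using assms(2) by (simp add: locally_finite_def)
  ultimately have fin: "finite (\<Union>j\<in>?R. {k. T (unit_vec k) j \<noteq> 0})" by blast
  have "{k. (S \<cdot> T) (unit_vec k) i \<noteq> 0} \<subseteq> (\<Union>j\<in>?R. {k. T (unit_vec k) j \<noteq> 0})"
  proof (clarsimp)
    fix k assume nz: "S (T (unit_vec k)) i \<noteq> 0"
    \<comment> \<open>The entry \<open>(i, k)\<close> of \<open>S T\<close> is the pairing of column \<open>k\<close> of \<open>T\<close> with row \<open>i\<close> of \<open>S\<close>.\<close>
    have Tk: "T (unit_vec k) \<in> finsupp"
      using lf_finsupp[OF assms(2) unit_vec_finsupp] .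
    have "pairing (T (unit_vec k)) (adj S (unit_vec i)) = pairing (S (T (unit_vec k))) (unit_vec i)"
      using pairing_adj[OF assms(1) Tk] by simp
    also have "\<dots> = cnj (S (T (unit_vec k)) i)"
      using lf_finsupp[OF assms(1) Tk]
      by (auto simp: pairing_def unit_vec_def finsupp_def if_distrib[of "\<lambda>x. _ * x"] cong: if_cong)
    finally have "pairing (T (unit_vec k)) (adj S (unit_vec i)) \<noteq> 0" using nz by simp
    then obtain j where "cnj (T (unit_vec k) j) * adj S (unit_vec i) j \<noteq> 0"
      unfolding pairing_def by (meson sum.neutral)
    then show "\<exists>j. adj S (unit_vec i) j \<noteq> 0 \<and> T (unit_vec k) j \<noteq> 0" by auto
  qed
  then show "finite {j. (S \<cdot> T) (unit_vec j) i \<noteq> 0}"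
    using fin finite_subset by blast
qed

lemma lf_sum:
  assumes "\<And>i. i \<in> F \<Longrightarrow> locally_finite (f i)"
  shows "locally_finite (\<Sum>i\<in>F. f i)"
  using assms by (induction F rule: infinite_finite_induct) (auto intro: lf_zero lf_add)

lemma lf_comm: "locally_finite S \<Longrightarrow> locally_finite T \<Longrightarrow> locally_finite (comm S T)"
  unfolding comm_def by (intro lf_diff lf_comp)

text \<open>Both sides are read off at a unit vector, where \<open>pairing_adj\<close> moves \<open>S\<close> across the pairing.\<close>

lemma adj_comp:
  assumes "locally_finite S" "locally_finite T"
  shows "adj (S \<cdot> T) = adj T \<cdot> adj S"
proof (intro ext)
  fix v j
  show "adj (S \<cdot> T) v j = (adj T \<cdot> adj S) v j"
    using pairing_adj[OF assms(1) lf_finsupp[OF assms(2) unit_vec_finsupp]]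
    by (simp add: adj_eq_pairing[of "S \<cdot> T"] adj_eq_pairing[of T])
qed

lemma adj_add:
  assumes "locally_finite S" "locally_finite T"
  shows "adj (S + T) = adj S + adj T"
proof (intro ext)
  fix v j
  show "adj (S + T) v j = (adj S + adj T) v j"
    using lf_finsupp[OF assms(1) unit_vec_finsupp] lf_finsupp[OF assms(2) unit_vec_finsupp]
    by (simp add: adj_eq_pairing pairing_add_left pointwise)
qed

lemma adj_scale: "adj (c *\<^sub>O T) = cnj c *\<^sub>O adj T"
  by (auto simp: pointwise fun_eq_iff adj_eq_pairing  scaleV_apply pairing_scale_left)

lemma adj_id: "adj id = id"
  by (auto simp: pointwise fun_eq_iff adj_eq_pairing pairing_unit)

lemma adj_zero: "adj 0 = 0"
  by (auto simp: pointwise fun_eq_iff adj_eq_pairing pairing_def)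

lemma adj_diff:
  assumes "locally_finite S" "locally_finite T"
  shows "adj (S - T) = adj S - adj T"
  using adj_add[OF assms(1) lf_scale[OF assms(2), of "-1"]] adj_scale[of "-1" T] by simp

lemma adj_sum:
  assumes "\<And>i. i \<in> F \<Longrightarrow> locally_finite (f i)"
  shows "adj (\<Sum>i\<in>F. f i) = (\<Sum>i\<in>F. adj (f i))"
  using assms
  by (induction F rule: infinite_finite_induct) (auto simp: adj_zero adj_add lf_sum)

text \<open>Operators are arbitrary functions on families of coefficients, so that only one of the two
  distributive laws is automatic.\<close>

lemma comp_distrib_left:
  "(S + T) \<cdot> R = S \<cdot> R + T \<cdot> R" "(S - T) \<cdot> R = S \<cdot> R - T \<cdot> R"
  "(- S) \<cdot> R = - (S \<cdot> R)" "(c *\<^sub>O S) \<cdot> R = c *\<^sub>O (S \<cdot> R)" "0 \<cdot> R = 0"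
  by (auto simp: pointwise fun_eq_iff )

lemma comp_distrib_right:
  assumes "linear_oper R"
  shows "R \<cdot> (S + T) = R \<cdot> S + R \<cdot> T" "R \<cdot> (S - T) = R \<cdot> S - R \<cdot> T"
    "R \<cdot> (- S) = - (R \<cdot> S)" "R \<cdot> (c *\<^sub>O S) = c *\<^sub>O (R \<cdot> S)" "R \<cdot> 0 = 0"
  using VV.linear_add[OF assms] VV.linear_diff[OF assms] VV.linear_scale[OF assms]
    VV.linear_neg[OF assms] VV.linear_0[OF assms]
  by (auto simp: pointwise fun_eq_iff )

lemma comp_sum_left: "(\<Sum>i\<in>F. f i) \<cdot> R = (\<Sum>i\<in>F. f i \<cdot> R)"
  by (simp add: fun_eq_iff sum_fun_apply)

lemma comp_sum_right:
  assumes "linear_oper R"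
  shows "R \<cdot> (\<Sum>i\<in>F. f i) = (\<Sum>i\<in>F. R \<cdot> f i)"
  by (intro ext) (simp add: sum_fun_apply VV.linear_sum[OF assms])

lemma comm_comp:
  assumes "linear_oper x"
  shows "comm D (x \<cdot> y) = comm D x \<cdot> y + x \<cdot> comm D y"
  by (simp add: comm_def comp_distrib_left comp_distrib_right[OF assms] o_assoc)

section \<open>Weighted shifts of the label\<close>

lemma coef_add: "coef (u + v) x = coef u x + coef v x"
  by (simp add: coef_def pointwise sum.distrib)

lemma coef_diff: "coef (u - v) x = coef u x - coef v x"
  by (simp add: coef_def pointwise sum_subtractf)

lemma coef_uminus: "coef (- v) x = - coef v x"
  by (simp add: coef_def pointwise sum_negf)

lemma coef_scale: "coef (c *\<^sub>V v) x = c * coef v x"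
  by (simp add: coef_def scaleV_apply sum_distrib_left)

lemma coef_zero: "coef 0 x = 0"
  by (simp add: coef_def pointwise)

lemma coef_cnj: "coef (\<lambda>i. cnj (v i)) x = cnj (coef v x)"
  by (simp add: coef_def cnj_sum)

lemmas coef_simps = coef_add coef_diff coef_uminus coef_scale coef_zero coef_cnj

lemma coef_outside: "x \<notin> range Rep_label \<Longrightarrow> coef v x = 0"
  unfolding coef_def by (rule sum.neutral) auto

lemma coef_unit_vec: "coef (unit_vec k) x = (if x = Rep_label k then 1 else 0)"
proof (cases "x \<in> range Rep_label")
  case True
  then obtain j where "Rep_label j = x" by auto
  then show ?thesis
    using coef_Rep_label[of j x "unit_vec k"] by (auto simp: unit_vec_def Rep_label_inject)
qed (auto simp: coef_outside)

lemma vec_eqI: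
  assumes "\<And>l m n \<sigma>. (l, m, n, \<sigma>) \<in> range Rep_label \<Longrightarrow> coef u (l, m, n, \<sigma>) = coef v (l, m, n, \<sigma>)"
  shows "u = v"
proof
  fix j
  obtain l m n \<sigma> where j: "Rep_label j = (l, m, n, \<sigma>)" by (cases "Rep_label j")
  then have "(l, m, n, \<sigma>) \<in> range Rep_label" by (metis rangeI)
  from assms[OF this] show "u j = v j" using coef_Rep_label[OF j] by metis
qed

lemma oper_eqI:
  assumes "\<And>v l m n \<sigma>. (l, m, n, \<sigma>) \<in> range Rep_label \<Longrightarrow>
    coef (S v) (l, m, n, \<sigma>) = coef (T v) (l, m, n, \<sigma>)"
  shows "S = T"
  by (intro ext[of S T] vec_eqI assms)

type_synonym coords = "real \<times> real \<times> real \<times> spin"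

text \<open>Multiplication by a weight after a change of labels. The generators, the grading, the spin
  operators and the ladder operators below are sums of such operators.\<close>

definition wshift :: "(coords \<Rightarrow> complex) \<Rightarrow> (coords \<Rightarrow> coords) \<Rightarrow> oper" where
  "wshift c t v = (\<lambda>j. c (Rep_label j) * coef v (t (Rep_label j)))"

lemma wshift_unit_vec:
  "wshift c t (unit_vec k) i = (if t (Rep_label i) = Rep_label k then c (Rep_label i) else 0)"
  by (simp add: wshift_def coef_unit_vec)

lemma lf_wshift:
  assumes "inj t"
  shows "locally_finite (wshift c t)"
  unfolding locally_finite_def finsupp_def mem_Collect_eq
proof (intro conjI allI)
  show "linear_oper (wshift c t)"
    by (rule linear_operI) (auto simp: wshift_def fun_eq_iff coef_simps pointwise scaleV_apply algebra_simps)
  have "{i. wshift c t (unit_vec j) i \<noteq> 0} \<subseteq> {i. Rep_label i = inv t (Rep_label j)}" for j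
    using inv_f_eq[OF assms] by (fastforce simp: wshift_unit_vec split: if_splits)
  then show "finite {i. wshift c t (unit_vec j) i \<noteq> 0}" for j
    using finite_Rep_label finite_subset by blast
  have "{j. wshift c t (unit_vec j) i \<noteq> 0} \<subseteq> {j. Rep_label j = t (Rep_label i)}" for i
    by (auto simp: wshift_unit_vec split: if_splits)
  then show "finite {j. wshift c t (unit_vec j) i \<noteq> 0}" for i
    using finite_Rep_label finite_subset by blast
qed

lemma adj_wshift:
  assumes "\<And>x. t' (t x) = x" "\<And>x. t (t' x) = x"
  shows "adj (wshift c t) = wshift (\<lambda>x. cnj (c (t' x))) t'"
proof (intro ext)
  fix v j
  let ?F = "{i. Rep_label i = t' (Rep_label j)}"
  have e: "t (Rep_label i) = Rep_label j \<longleftrightarrow> Rep_label i = t' (Rep_label j)" for i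
    using assms by metis
  have "adj (wshift c t) v j = (\<Sum>i\<in>?F. cnj (wshift c t (unit_vec j) i) * v i)"
    unfolding adj_eq_pairing using finite_Rep_label
    by (intro pairing_superset) (auto simp: wshift_unit_vec e assms split: if_splits)
  also have "\<dots> = (\<Sum>i\<in>?F. cnj (c (t' (Rep_label j))) * v i)"
    by (rule sum.cong) (auto simp: wshift_unit_vec e assms)
  also have "\<dots> = wshift (\<lambda>x. cnj (c (t' x))) t' v j"
    by (simp add: wshift_def coef_def sum_distrib_left)
  finally show "adj (wshift c t) v j = wshift (\<lambda>x. cnj (c (t' x))) t' v j" .
qed

text \<open>A label shifted out of the admissible range contributes nothing if the weight vanishes there.
  The coefficients of an image are then given by one formula for all labels, so that
  compositions can be computed without regard to the boundary of the range.\<close>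

lemma coef_wshift:
  assumes "x \<notin> range Rep_label \<Longrightarrow> t x \<in> range Rep_label \<Longrightarrow> c x = 0"
  shows "coef (wshift c t v) x = c x * coef v (t x)"
proof (cases "x \<in> range Rep_label")
  case True
  then obtain j where "Rep_label j = x" by auto
  then show ?thesis by (simp add: coef_Rep_label wshift_def)
next
  case False
  then show ?thesis using assms coef_outside by (cases "t x \<in> range Rep_label") auto
qed

subsection \<open>Operators on the spin label\<close>

definition spin_op :: "(spin \<Rightarrow> complex) \<Rightarrow> (spin \<Rightarrow> spin) \<Rightarrow> oper" where
  "spin_op c f = wshift (\<lambda>(l, m, n, \<sigma>). c \<sigma>) (\<lambda>(l, m, n, \<sigma>). (l, m, n, f \<sigma>))"

lemma coef_spin_op: "coef (spin_op c f v) (l, m, n, \<sigma>) = c \<sigma> * coef v (l, m, n, f \<sigma>)"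
  unfolding spin_op_def by (subst coef_wshift) (auto simp: range_Rep_label)

lemma flip_flip: "flip (flip \<sigma>) = \<sigma>"
  by (cases \<sigma>) auto

lemma lf_spin_op:
  assumes "\<And>\<sigma>. f (f \<sigma>) = \<sigma>"
  shows "locally_finite (spin_op c f)"
  unfolding spin_op_def by (rule lf_wshift) (auto simp: inj_def, metis assms)

lemma adj_spin_op:
  assumes "\<And>\<sigma>. f (f \<sigma>) = \<sigma>"
  shows "adj (spin_op c f) = spin_op (\<lambda>\<sigma>. cnj (c (f \<sigma>))) f"
  unfolding spin_op_def
  by (subst adj_wshift[where t' = "\<lambda>(l, m, n, \<sigma>). (l, m, n, f \<sigma>)"])
    (auto simp: assms intro!: arg_cong2[of _ _ _ _ wshift])

lemma Gamma_eq_spin_op: "\<Gamma>op = spin_op (\<lambda>\<sigma>. of_real (spin_sign \<sigma>)) id"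
proof (intro ext)
  fix v j
  obtain l m n \<sigma> where j: "Rep_label j = (l, m, n, \<sigma>)" by (cases "Rep_label j")
  \<comment> \<open>The row has one entry; the second label only has to differ from the first.\<close>
  have "image_of (\<lambda>l m n \<sigma>. spin_sign \<sigma> *\<^sub>V ket l m n \<sigma>) i j
     = (if Rep_label i = (l, m, n, \<sigma>) then complex_of_real (spin_sign \<sigma>) else 0)
       + (if Rep_label i = (l + 1, m, n, \<sigma>) then 0 else 0)" for i
    by (cases "Rep_label i") (auto simp: image_of_def ket_def scaleV_def j)
  from sum_two[OF this, of v] show "\<Gamma>op v j = spin_op (\<lambda>\<sigma>. of_real (spin_sign \<sigma>)) id v j"
    by (simp add: \<Gamma>op_def lin_ext_def spin_op_def wshift_def j)
qed

lemma coef_Gamma: "coef (\<Gamma>op v) (l, m, n, \<sigma>) = of_real (spin_sign \<sigma>) * coef v (l, m, n, \<sigma>)"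
  by (simp add: Gamma_eq_spin_op coef_spin_op)

lemma lf_Gamma: "locally_finite \<Gamma>op"
  by (simp add: Gamma_eq_spin_op lf_spin_op)

lemma Gamma_Gamma: "\<Gamma>op \<cdot> \<Gamma>op = id"
proof (rule oper_eqI)
  fix v l m n \<sigma>
  show "coef ((\<Gamma>op \<cdot> \<Gamma>op) v) (l, m, n, \<sigma>) = coef (id v) (l, m, n, \<sigma>)"
    by (cases \<sigma>) (simp_all add: coef_Gamma)
qed

lemma delta_eq_wshift: "\<delta>op = wshift (\<lambda>(l, m, n, \<sigma>). of_real (2 * m + spin_sign \<sigma>)) id"
proof (intro ext)
  fix v j
  obtain l m n \<sigma> where j: "Rep_label j = (l, m, n, \<sigma>)" by (cases "Rep_label j")
  then show "\<delta>op v j = wshift (\<lambda>(l, m, n, \<sigma>). of_real (2 * m + spin_sign \<sigma>)) id v j"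
    by (simp add: delta_apply[OF j] wshift_def coef_Rep_label[OF j])
qed

lemma lf_delta: "locally_finite \<delta>op"
  unfolding delta_eq_wshift by (rule lf_wshift) simp

lemma adj_delta: "adj \<delta>op = \<delta>op"
  unfolding delta_eq_wshift
  by (subst adj_wshift[where t' = id]) (auto intro!: arg_cong2[of _ _ _ _ wshift])

subsection \<open>Raising and lowering \<open>m\<close>\<close>

text \<open>The ladder operators \<open>L\<^sub>+\<close> and \<open>L\<^sub>-\<close> of the spin-\<open>l\<close> representations acting on the label \<open>m\<close>. A
  coefficient of the image at \<open>m\<close> comes from the label \<open>m - 1\<close>, respectively \<open>m + 1\<close>.\<close>

definition raise_op :: oper where
  "raise_op = wshift (\<lambda>(l, m, n, \<sigma>). of_real (sqrt (l + m) * sqrt (l - m + 1))) (\<lambda>(l, m, n, \<sigma>). (l, m - 1, n, \<sigma>))"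

definition lower_op :: oper where
  "lower_op = wshift (\<lambda>(l, m, n, \<sigma>). of_real (sqrt (l - m) * sqrt (l + m + 1))) (\<lambda>(l, m, n, \<sigma>). (l, m + 1, n, \<sigma>))"

lemma coef_raise:
  "coef (raise_op v) (l, m, n, \<sigma>) = of_real (sqrt (l + m) * sqrt (l - m + 1)) * coef v (l, m - 1, n, \<sigma>)"
  unfolding raise_op_def
proof (subst coef_wshift, goal_cases)
  case 1
  then have r: "(l, m - 1, n, \<sigma>) \<in> range Rep_label" "(l, m, n, \<sigma>) \<notin> range Rep_label" by auto
  then have "l - m + 1 = 0"
    using Nats_real_pred[of "l - m + 1"] Nats_real_Suc[of "l + m - 1"]
    by (auto simp: range_Rep_label algebra_simps)
  then show ?case by (simp add: algebra_simps)
qed simp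

lemma coef_lower:
  "coef (lower_op v) (l, m, n, \<sigma>) = of_real (sqrt (l - m) * sqrt (l + m + 1)) * coef v (l, m + 1, n, \<sigma>)"
  unfolding lower_op_def
proof (subst coef_wshift, goal_cases)
  case 1
  then have r: "(l, m + 1, n, \<sigma>) \<in> range Rep_label" "(l, m, n, \<sigma>) \<notin> range Rep_label" by auto
  then have "l + m + 1 = 0"
    using Nats_real_pred[of "l + m + 1"] Nats_real_Suc[of "l - m - 1"]
    by (auto simp: range_Rep_label algebra_simps)
  then show ?case by (simp add: algebra_simps)
qed simp

lemma lf_raise: "locally_finite raise_op"
  unfolding raise_op_def by (rule lf_wshift) (auto simp: inj_def)

lemma lf_lower: "locally_finite lower_op"
  unfolding lower_op_def by (rule lf_wshift) (auto simp: inj_def)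

lemma adj_raise: "adj raise_op = lower_op"
  unfolding raise_op_def lower_op_def
  by (subst adj_wshift[where t' = "\<lambda>(l, m, n, \<sigma>). (l, m + 1, n, \<sigma>)"])
    (auto simp: algebra_simps intro!: arg_cong2[of _ _ _ _ wshift])

lemma adj_lower: "adj lower_op = raise_op"
  unfolding raise_op_def lower_op_def
  by (subst adj_wshift[where t' = "\<lambda>(l, m, n, \<sigma>). (l, m - 1, n, \<sigma>)"])
    (auto simp: algebra_simps intro!: arg_cong2[of _ _ _ _ wshift])

lemma spin_op_raise: "spin_op c f \<cdot> raise_op = raise_op \<cdot> spin_op c f"
  by (rule oper_eqI) (simp add: coef_spin_op coef_raise)

lemma spin_op_lower: "spin_op c f \<cdot> lower_op = lower_op \<cdot> spin_op c f"
  by (rule oper_eqI) (simp add: coef_spin_op coef_lower)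

subsection \<open>The generators\<close>

text \<open>A step from \<open>l + 1/2\<close> down to \<open>l\<close> leaves the admissible range only from a label with \<open>l + 1/2 = m - 1/2\<close> or
  \<open>l + 1/2 = -(n + 1/2)\<close>, where the weight \<open>da\<close> vanishes.\<close>

lemma coef_opa: "coef (opa \<theta> v) (l, m, n, \<sigma>) =
    ua \<theta> (l - 1/2) (m - 1/2) (n + 1/2) * coef v (l - 1/2, m - 1/2, n + 1/2, \<sigma>) +
    da \<theta> (l + 1/2) (m - 1/2) (n + 1/2) * coef v (l + 1/2, m - 1/2, n + 1/2, \<sigma>)"
proof (cases "(l, m, n, \<sigma>) \<in> range Rep_label")
  case True
  then show ?thesis unfolding opa_def genA.coef_val by simp
next
  case False
  have "coef v (l - 1/2, m - 1/2, n + 1/2, \<sigma>) = 0"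
  proof (rule coef_outside, rule notI)
    assume r: "(l - 1/2, m - 1/2, n + 1/2, \<sigma>) \<in> range Rep_label"
    then have "(l, m, n, \<sigma>) \<in> range Rep_label"
      using Nats_real_Suc[of "2 * l - 1"] Nats_real_Suc[of "l + m - 1"] Nats_real_Suc[of "l - n - 1"]
      by (auto simp: range_Rep_label algebra_simps)
    with False show False by simp
  qed
  moreover have "da \<theta> (l + 1/2) (m - 1/2) (n + 1/2) * coef v (l + 1/2, m - 1/2, n + 1/2, \<sigma>) = 0"
  proof (rule ccontr)
    assume asm: "\<not> ?thesis"
    then have nz: "l - m + 1 \<noteq> 0" "l + n + 1 \<noteq> 0"
      by (auto simp: da_def algebra_simps)
    have "(l + 1/2, m - 1/2, n + 1/2, \<sigma>) \<in> range Rep_label"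
      using asm coef_outside by (metis mult_zero_right)
    then have "l - m + 1 \<in> \<nat>" "l + n + 1 \<in> \<nat>" "l + m \<in> \<nat>" "l - n \<in> \<nat>"
      by (auto simp: range_Rep_label algebra_simps)
    moreover have "l - m \<in> \<nat>" "l + n \<in> \<nat>"
      using Nats_real_pred[OF calculation(1) nz(1)] Nats_real_pred[OF calculation(2) nz(2)] by simp_all
    ultimately have "(l, m, n, \<sigma>) \<in> range Rep_label"
      using Nats_add[of "l - m" "l + m"] by (simp add: range_Rep_label)
    with False show False by simp
  qed
  ultimately show ?thesis using False by (simp add: coef_outside)
qed

lemma coef_opb: "coef (opb \<theta> v) (l, m, n, \<sigma>) =
    ub \<theta> (l - 1/2) (m + 1/2) (n + 1/2) * coef v (l - 1/2, m + 1/2, n + 1/2, \<sigma>) +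
    db \<theta> (l + 1/2) (m + 1/2) (n + 1/2) * coef v (l + 1/2, m + 1/2, n + 1/2, \<sigma>)"
proof (cases "(l, m, n, \<sigma>) \<in> range Rep_label")
  case True
  then show ?thesis unfolding opb_def genB.coef_val by simp
next
  case False
  have "coef v (l - 1/2, m + 1/2, n + 1/2, \<sigma>) = 0"
  proof (rule coef_outside, rule notI)
    assume r: "(l - 1/2, m + 1/2, n + 1/2, \<sigma>) \<in> range Rep_label"
    then have "(l, m, n, \<sigma>) \<in> range Rep_label"
      using Nats_real_Suc[of "2 * l - 1"] Nats_real_Suc[of "l - m - 1"] Nats_real_Suc[of "l - n - 1"]
      by (auto simp: range_Rep_label algebra_simps)
    with False show False by simp
  qed
  moreover have "db \<theta> (l + 1/2) (m + 1/2) (n + 1/2) * coef v (l + 1/2, m + 1/2, n + 1/2, \<sigma>) = 0"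
  proof (rule ccontr)
    assume asm: "\<not> ?thesis"
    then have nz: "l + m + 1 \<noteq> 0" "l + n + 1 \<noteq> 0"
      by (auto simp: db_def algebra_simps)
    have "(l + 1/2, m + 1/2, n + 1/2, \<sigma>) \<in> range Rep_label"
      using asm coef_outside by (metis mult_zero_right)
    then have "l + m + 1 \<in> \<nat>" "l + n + 1 \<in> \<nat>" "l - m \<in> \<nat>" "l - n \<in> \<nat>"
      by (auto simp: range_Rep_label algebra_simps)
    moreover have "l + m \<in> \<nat>" "l + n \<in> \<nat>"
      using Nats_real_pred[OF calculation(1) nz(1)] Nats_real_pred[OF calculation(2) nz(2)] by simp_all
    ultimately have "(l, m, n, \<sigma>) \<in> range Rep_label"
      using Nats_add[of "l - m" "l + m"] by (simp add: range_Rep_label)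
    with False show False by simp
  qed
  ultimately show ?thesis using False by (simp add: coef_outside)
qed

lemma lf_opa: "locally_finite (opa \<theta>)"
proof -
  have eq: "opa \<theta> =
      wshift (\<lambda>(l, m, n, \<sigma>). ua \<theta> (l - 1/2) (m - 1/2) (n + 1/2)) (\<lambda>(l, m, n, \<sigma>). (l - 1/2, m - 1/2, n + 1/2, \<sigma>)) +
      wshift (\<lambda>(l, m, n, \<sigma>). da \<theta> (l + 1/2) (m - 1/2) (n + 1/2)) (\<lambda>(l, m, n, \<sigma>). (l + 1/2, m - 1/2, n + 1/2, \<sigma>))"
  proof (intro ext)
    fix v j
    obtain l m n \<sigma> where j: "Rep_label j = (l, m, n, \<sigma>)" by (cases "Rep_label j")
    show "opa \<theta> v j = (wshift (\<lambda>(l, m, n, \<sigma>). ua \<theta> (l - 1/2) (m - 1/2) (n + 1/2)) (\<lambda>(l, m, n, \<sigma>). (l - 1/2, m - 1/2, n + 1/2, \<sigma>)) +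
      wshift (\<lambda>(l, m, n, \<sigma>). da \<theta> (l + 1/2) (m - 1/2) (n + 1/2)) (\<lambda>(l, m, n, \<sigma>). (l + 1/2, m - 1/2, n + 1/2, \<sigma>))) v j"
      unfolding genA.val[OF j, folded opa_def] oper_apply plus_fun_apply wshift_def j by simp
  qed
  show ?thesis
    unfolding eq by (intro lf_add lf_wshift) (auto simp: inj_def)
qed

lemma lf_opb: "locally_finite (opb \<theta>)"
proof -
  have eq: "opb \<theta> =
      wshift (\<lambda>(l, m, n, \<sigma>). ub \<theta> (l - 1/2) (m + 1/2) (n + 1/2)) (\<lambda>(l, m, n, \<sigma>). (l - 1/2, m + 1/2, n + 1/2, \<sigma>)) +
      wshift (\<lambda>(l, m, n, \<sigma>). db \<theta> (l + 1/2) (m + 1/2) (n + 1/2)) (\<lambda>(l, m, n, \<sigma>). (l + 1/2, m + 1/2, n + 1/2, \<sigma>))"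
  proof (intro ext)
    fix v j
    obtain l m n \<sigma> where j: "Rep_label j = (l, m, n, \<sigma>)" by (cases "Rep_label j")
    show "opb \<theta> v j = (wshift (\<lambda>(l, m, n, \<sigma>). ub \<theta> (l - 1/2) (m + 1/2) (n + 1/2)) (\<lambda>(l, m, n, \<sigma>). (l - 1/2, m + 1/2, n + 1/2, \<sigma>)) +
      wshift (\<lambda>(l, m, n, \<sigma>). db \<theta> (l + 1/2) (m + 1/2) (n + 1/2)) (\<lambda>(l, m, n, \<sigma>). (l + 1/2, m + 1/2, n + 1/2, \<sigma>))) v j"
      unfolding genB.val[OF j, folded opb_def] oper_apply plus_fun_apply wshift_def j by simp
  qed
  show ?thesis
    unfolding eq by (intro lf_add lf_wshift) (auto simp: inj_def)
qed

lemma opa_spin_op: "opa \<theta> \<cdot> spin_op c f = spin_op c f \<cdot> opa \<theta>"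
  by (rule oper_eqI) (simp only: o_apply coef_spin_op coef_opa distrib_left mult.left_commute)

lemma opb_spin_op: "opb \<theta> \<cdot> spin_op c f = spin_op c f \<cdot> opb \<theta>"
  by (rule oper_eqI) (simp only: o_apply coef_spin_op coef_opb distrib_left mult.left_commute)


subsection \<open>The generators as a doublet\<close>

lemma range_nonneg:
  assumes "(l, m, n, \<sigma>) \<in> range Rep_label"
  shows "0 \<le> l + m" "0 \<le> l - m" "0 \<le> l + n" "0 \<le> l - n" "0 \<le> l"
proof -
  show "0 \<le> l + m" "0 \<le> l - m" "0 \<le> l + n" "0 \<le> l - n"
    using assms unfolding range_Rep_label by (intro Nats_real_nonneg; simp)+
  then show "0 \<le> l" by linarith
qed

text \<open>The coefficients of \<open>[L\<^sub>-, a]\<close> and \<open>[L\<^sub>+, b]\<close> are differences of products of square roots which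
  collapse by \<open>(x + 1) - x = 1\<close>, with \<open>x = l + m\<close> or \<open>x = l - m\<close>. The companion lemma is for the components lowering
  \<open>l\<close>, where the roles of \<open>x\<close> and \<open>x + 1\<close> are exchanged.\<close>

lemma doublet_weight:
  fixes L :: complex
  assumes "0 \<le> x"
  shows "of_real (A * sqrt (x + 1)) * (L * of_real (sqrt (x + 1) * C / N))
     - L * of_real (sqrt x * C / N) * of_real (A * sqrt x) = L * of_real (A * C / N)"
proof -
  have "A * a * (a * C / N) - b * C / N * (A * b) = (a * a - b * b) * (A * C / N)" for a b :: real
    by (simp add: divide_inverse algebra_simps)
  from this[of "sqrt (x + 1)" "sqrt x"]
  have "A * sqrt (x + 1) * (sqrt (x + 1) * C / N) - sqrt x * C / N * (A * sqrt x) = A * C / N"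
    using assms by simp
  from arg_cong[OF this, of "\<lambda>y. L * of_real y"] show ?thesis
    unfolding of_real_diff right_diff_distrib of_real_mult[symmetric] 
    by (simp only: of_real_mult mult.assoc mult.left_commute)
qed

lemma doublet_weight':
  fixes L :: complex
  assumes "0 \<le> x"
  shows "of_real (sqrt x * A) * (L * of_real (sqrt x * C / N))
     - L * of_real (sqrt (x + 1) * C / N) * of_real (sqrt (x + 1) * A) = - (L * of_real (A * C / N))"
proof -
  have "of_real (sqrt x * A) * (L * of_real (sqrt x * C / N)) = L * of_real (sqrt x * C / N) * of_real (A * sqrt x)"
    "L * of_real (sqrt (x + 1) * C / N) * of_real (sqrt (x + 1) * A)
      = of_real (A * sqrt (x + 1)) * (L * of_real (sqrt (x + 1) * C / N))"
    by (simp_all only: mult_ac)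
  then show ?thesis
    using doublet_weight[OF assms, of A L C N] by (metis minus_diff_eq)
qed

lemma lam_uminus: "lam (- \<theta>) x = lam \<theta> (- x)"
  by (simp add: lam_def)

text \<open>The weights with their arguments brought into a prescribed form.\<close>

lemma ua_eq:
  assumes "- n = x" "l + 1 + m = p" "l + 1 - n = q" "2 * l + 1 = c" "2 * l + 2 = d"
  shows "ua \<theta> l m n = lam \<theta> x * of_real (sqrt p * sqrt q / (sqrt c * sqrt d))"
  unfolding ua_def assms(2-)[symmetric] assms(1) ..

lemma da_eq:
  assumes "- n = x" "l - m = p" "l + n = q" "2 * l = c" "2 * l + 1 = d"
  shows "da \<theta> l m n = - (lam \<theta> x * of_real (sqrt p * sqrt q / (sqrt c * sqrt d)))"
  unfolding da_def assms(2-)[symmetric] assms(1) mult_minus_left ..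

lemma ub_eq:
  assumes "n = x" "l + 1 - m = p" "l + 1 - n = q" "2 * l + 1 = c" "2 * l + 2 = d"
  shows "ub \<theta> l m n = lam \<theta> x * of_real (sqrt p * sqrt q / (sqrt c * sqrt d))"
  unfolding ub_def assms(2-)[symmetric] assms(1) ..

lemma db_eq:
  assumes "n = x" "l + m = p" "l + n = q" "2 * l = c" "2 * l + 1 = d"
  shows "db \<theta> l m n = lam \<theta> x * of_real (sqrt p * sqrt q / (sqrt c * sqrt d))"
  unfolding db_def assms(2-)[symmetric] assms(1) ..

lemma coef_raise_eq:
  assumes "l + m = p" "l - m + 1 = q" "m - 1 = m'"
  shows "coef (raise_op v) (l, m, n, \<sigma>) = of_real (sqrt p * sqrt q) * coef v (l, m', n, \<sigma>)"
  unfolding coef_raise assms ..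

lemma coef_lower_eq:
  assumes "l - m = p" "l + m + 1 = q" "m + 1 = m'"
  shows "coef (lower_op v) (l, m, n, \<sigma>) = of_real (sqrt p * sqrt q) * coef v (l, m', n, \<sigma>)"
  unfolding coef_lower assms ..

lemma coef_comm_two_terms:
  fixes w :: complex
  shows "w * (x * c + y * d) - (x' * (wx * c) + y' * (wy * d))
    = (w * x - x' * wx) * c + (w * y - y' * wy) * d"
  by (simp add: algebra_simps)

lemma balanced_weight:
  fixes L :: complex
  shows "of_real (A * B) * (L * of_real (A' * C / N)) = L * of_real (A * C / N) * of_real (A' * B)"
  by (simp add: divide_inverse mult_ac)

text \<open>The ladder operators ignore \<open>n\<close> and therefore commute with the twist \<open>\<lambda>\<^sup>-\<^sup>n\<close> in \<open>a\<close>. So \<open>[L\<^sub>-, a]\<close> is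
  the untwisted \<open>b\<close> with this twist, whereas \<open>b\<close> itself carries \<open>\<lambda>\<^sup>n\<close>; this is the generator \<open>b\<close> for \<open>-\<theta>\<close>.\<close>

lemma comm_lower_opa: "comm lower_op (opa \<theta>) = opb (- \<theta>)"
proof (rule oper_eqI)
  fix v l m n \<sigma> assume "(l, m, n, \<sigma>) \<in> range Rep_label"
  note p = range_nonneg[OF this]
  let ?L = "lam \<theta> (- (n + 1/2))"
  let ?N = "sqrt (2 * l) * sqrt (2 * l + 1)" and ?N' = "sqrt (2 * l + 1) * sqrt (2 * l + 2)"
  have u1: "ua \<theta> (l - 1/2) (m + 1/2) (n + 1/2) = ?L * of_real (sqrt (l + m + 1) * sqrt (l - n) / ?N)"
    by (rule ua_eq; simp)
  have u2: "ua \<theta> (l - 1/2) (m - 1/2) (n + 1/2) = ?L * of_real (sqrt (l + m) * sqrt (l - n) / ?N)"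
    by (rule ua_eq; simp)
  have u3: "ub (- \<theta>) (l - 1/2) (m + 1/2) (n + 1/2) = ?L * of_real (sqrt (l - m) * sqrt (l - n) / ?N)"
    unfolding lam_uminus[of \<theta> "n + 1/2", symmetric] by (rule ub_eq; simp)
  have d1: "da \<theta> (l + 1/2) (m + 1/2) (n + 1/2) = - (?L * of_real (sqrt (l - m) * sqrt (l + n + 1) / ?N'))"
    by (rule da_eq; simp)
  have d2: "da \<theta> (l + 1/2) (m - 1/2) (n + 1/2) = - (?L * of_real (sqrt (l - m + 1) * sqrt (l + n + 1) / ?N'))"
    by (rule da_eq; simp)
  have d3: "db (- \<theta>) (l + 1/2) (m + 1/2) (n + 1/2) = ?L * of_real (sqrt (l + m + 1) * sqrt (l + n + 1) / ?N')"
    unfolding lam_uminus[of \<theta> "n + 1/2", symmetric] by (rule db_eq; simp)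
  let ?w = "of_real (sqrt (l - m) * sqrt (l + m + 1)) :: complex"
  have up: "?w * ua \<theta> (l - 1/2) (m + 1/2) (n + 1/2)
      - ua \<theta> (l - 1/2) (m - 1/2) (n + 1/2) * of_real (sqrt (l - m) * sqrt (l + m))
      = ub (- \<theta>) (l - 1/2) (m + 1/2) (n + 1/2)"
    unfolding u1 u2 u3 by (rule doublet_weight[OF p(1)])
  have down: "?w * da \<theta> (l + 1/2) (m + 1/2) (n + 1/2)
      - da \<theta> (l + 1/2) (m - 1/2) (n + 1/2) * of_real (sqrt (l - m + 1) * sqrt (l + m + 1))
      = db (- \<theta>) (l + 1/2) (m + 1/2) (n + 1/2)"
    unfolding d1 d2 d3 using arg_cong[OF doublet_weight'[OF p(2)], of uminus]
    by (simp only: mult_minus_left mult_minus_right minus_diff_minus minus_minus)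
  have "coef (lower_op v) (l - 1/2, m - 1/2, n + 1/2, \<sigma>)
      = of_real (sqrt (l - m) * sqrt (l + m)) * coef v (l - 1/2, m + 1/2, n + 1/2, \<sigma>)"
    "coef (lower_op v) (l + 1/2, m - 1/2, n + 1/2, \<sigma>)
      = of_real (sqrt (l - m + 1) * sqrt (l + m + 1)) * coef v (l + 1/2, m + 1/2, n + 1/2, \<sigma>)"
    by (rule coef_lower_eq; simp)+
  moreover have "m + 1 - 1/2 = m + 1/2" by simp
  ultimately show "coef (comm lower_op (opa \<theta>) v) (l, m, n, \<sigma>) = coef (opb (- \<theta>) v) (l, m, n, \<sigma>)"
    unfolding up[symmetric] down[symmetric] coef_opb comm_def oper_apply o_apply coef_diff
    by (simp only: coef_lower[of _ l m n] coef_opa coef_comm_two_terms)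
qed

lemma comm_raise_opb: "comm raise_op (opb \<theta>) = opa (- \<theta>)"
proof (rule oper_eqI)
  fix v l m n \<sigma> assume "(l, m, n, \<sigma>) \<in> range Rep_label"
  note p = range_nonneg[OF this]
  let ?L = "lam \<theta> (n + 1/2)"
  let ?N = "sqrt (2 * l) * sqrt (2 * l + 1)" and ?N' = "sqrt (2 * l + 1) * sqrt (2 * l + 2)"
  have lam: "lam (- \<theta>) (- (n + 1/2)) = ?L" unfolding lam_uminus minus_minus ..
  have u1: "ub \<theta> (l - 1/2) (m - 1/2) (n + 1/2) = ?L * of_real (sqrt (l - m + 1) * sqrt (l - n) / ?N)"
    by (rule ub_eq; simp)
  have u2: "ub \<theta> (l - 1/2) (m + 1/2) (n + 1/2) = ?L * of_real (sqrt (l - m) * sqrt (l - n) / ?N)"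
    by (rule ub_eq; simp)
  have u3: "ua (- \<theta>) (l - 1/2) (m - 1/2) (n + 1/2) = ?L * of_real (sqrt (l + m) * sqrt (l - n) / ?N)"
    unfolding lam[symmetric] by (rule ua_eq; simp)
  have d1: "db \<theta> (l + 1/2) (m - 1/2) (n + 1/2) = ?L * of_real (sqrt (l + m) * sqrt (l + n + 1) / ?N')"
    by (rule db_eq; simp)
  have d2: "db \<theta> (l + 1/2) (m + 1/2) (n + 1/2) = ?L * of_real (sqrt (l + m + 1) * sqrt (l + n + 1) / ?N')"
    by (rule db_eq; simp)
  have d3: "da (- \<theta>) (l + 1/2) (m - 1/2) (n + 1/2) = - (?L * of_real (sqrt (l - m + 1) * sqrt (l + n + 1) / ?N'))"
    unfolding lam[symmetric] by (rule da_eq; simp)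
  let ?w = "of_real (sqrt (l + m) * sqrt (l - m + 1)) :: complex"
  have up: "?w * ub \<theta> (l - 1/2) (m - 1/2) (n + 1/2)
      - ub \<theta> (l - 1/2) (m + 1/2) (n + 1/2) * of_real (sqrt (l + m) * sqrt (l - m))
      = ua (- \<theta>) (l - 1/2) (m - 1/2) (n + 1/2)"
    unfolding u1 u2 u3 by (rule doublet_weight[OF p(2)])
  have down: "?w * db \<theta> (l + 1/2) (m - 1/2) (n + 1/2)
      - db \<theta> (l + 1/2) (m + 1/2) (n + 1/2) * of_real (sqrt (l + m + 1) * sqrt (l - m + 1))
      = da (- \<theta>) (l + 1/2) (m - 1/2) (n + 1/2)"
    unfolding d1 d2 d3 by (rule doublet_weight'[OF p(1)])
  have "coef (raise_op v) (l - 1/2, m + 1/2, n + 1/2, \<sigma>)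
      = of_real (sqrt (l + m) * sqrt (l - m)) * coef v (l - 1/2, m - 1/2, n + 1/2, \<sigma>)"
    "coef (raise_op v) (l + 1/2, m + 1/2, n + 1/2, \<sigma>)
      = of_real (sqrt (l + m + 1) * sqrt (l - m + 1)) * coef v (l + 1/2, m - 1/2, n + 1/2, \<sigma>)"
    by (rule coef_raise_eq; simp)+
  moreover have "m - 1 + 1/2 = m - 1/2" by simp
  ultimately show "coef (comm raise_op (opb \<theta>) v) (l, m, n, \<sigma>) = coef (opa (- \<theta>) v) (l, m, n, \<sigma>)"
    unfolding up[symmetric] down[symmetric] coef_opa comm_def oper_apply o_apply coef_diff
    by (simp only: coef_raise[of _ l m n] coef_opb coef_comm_two_terms)
qed

lemma comm_raise_opa: "comm raise_op (opa \<theta>) = 0"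
proof (rule oper_eqI)
  fix v l m n \<sigma>
  let ?L = "lam \<theta> (- (n + 1/2))"
  let ?N = "sqrt (2 * l) * sqrt (2 * l + 1)" and ?N' = "sqrt (2 * l + 1) * sqrt (2 * l + 2)"
  have u1: "ua \<theta> (l - 1/2) (m - 3/2) (n + 1/2) = ?L * of_real (sqrt (l + m - 1) * sqrt (l - n) / ?N)"
    by (rule ua_eq; simp)
  have u2: "ua \<theta> (l - 1/2) (m - 1/2) (n + 1/2) = ?L * of_real (sqrt (l + m) * sqrt (l - n) / ?N)"
    by (rule ua_eq; simp)
  have d1: "da \<theta> (l + 1/2) (m - 3/2) (n + 1/2) = - (?L * of_real (sqrt (l - m + 2) * sqrt (l + n + 1) / ?N'))"
    by (rule da_eq; simp)
  have d2: "da \<theta> (l + 1/2) (m - 1/2) (n + 1/2) = - (?L * of_real (sqrt (l - m + 1) * sqrt (l + n + 1) / ?N'))"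
    by (rule da_eq; simp)
  let ?w = "of_real (sqrt (l + m) * sqrt (l - m + 1)) :: complex"
  have up: "?w * ua \<theta> (l - 1/2) (m - 3/2) (n + 1/2)
      - ua \<theta> (l - 1/2) (m - 1/2) (n + 1/2) * of_real (sqrt (l + m - 1) * sqrt (l - m + 1)) = 0"
    unfolding u1 u2 balanced_weight by simp
  have down: "?w * da \<theta> (l + 1/2) (m - 3/2) (n + 1/2)
      - da \<theta> (l + 1/2) (m - 1/2) (n + 1/2) * of_real (sqrt (l + m) * sqrt (l - m + 2)) = 0"
    unfolding d1 d2 mult_minus_left mult_minus_right mult.commute[of "sqrt (l + m)"] balanced_weight by simp
  have "coef (raise_op v) (l - 1/2, m - 1/2, n + 1/2, \<sigma>)
      = of_real (sqrt (l + m - 1) * sqrt (l - m + 1)) * coef v (l - 1/2, m - 3/2, n + 1/2, \<sigma>)"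
    "coef (raise_op v) (l + 1/2, m - 1/2, n + 1/2, \<sigma>)
      = of_real (sqrt (l + m) * sqrt (l - m + 2)) * coef v (l + 1/2, m - 3/2, n + 1/2, \<sigma>)"
    by (rule coef_raise_eq; simp)+
  moreover have "m - 1 - 1/2 = m - 3/2" by simp
  ultimately show "coef (comm raise_op (opa \<theta>) v) (l, m, n, \<sigma>) = coef (0 v) (l, m, n, \<sigma>)"
    unfolding comm_def oper_apply o_apply coef_diff coef_zero
    by (simp only: coef_raise[of _ l m n] coef_opa coef_comm_two_terms up down) simp
qed

lemma comm_lower_opb: "comm lower_op (opb \<theta>) = 0"
proof (rule oper_eqI)
  fix v l m n \<sigma>
  let ?L = "lam \<theta> (n + 1/2)"
  let ?N = "sqrt (2 * l) * sqrt (2 * l + 1)" and ?N' = "sqrt (2 * l + 1) * sqrt (2 * l + 2)"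
  have u1: "ub \<theta> (l - 1/2) (m + 3/2) (n + 1/2) = ?L * of_real (sqrt (l - m - 1) * sqrt (l - n) / ?N)"
    by (rule ub_eq; simp)
  have u2: "ub \<theta> (l - 1/2) (m + 1/2) (n + 1/2) = ?L * of_real (sqrt (l - m) * sqrt (l - n) / ?N)"
    by (rule ub_eq; simp)
  have d1: "db \<theta> (l + 1/2) (m + 3/2) (n + 1/2) = ?L * of_real (sqrt (l + m + 2) * sqrt (l + n + 1) / ?N')"
    by (rule db_eq; simp)
  have d2: "db \<theta> (l + 1/2) (m + 1/2) (n + 1/2) = ?L * of_real (sqrt (l + m + 1) * sqrt (l + n + 1) / ?N')"
    by (rule db_eq; simp)
  let ?w = "of_real (sqrt (l - m) * sqrt (l + m + 1)) :: complex"
  have up: "?w * ub \<theta> (l - 1/2) (m + 3/2) (n + 1/2)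
      - ub \<theta> (l - 1/2) (m + 1/2) (n + 1/2) * of_real (sqrt (l - m - 1) * sqrt (l + m + 1)) = 0"
    unfolding u1 u2 balanced_weight by simp
  have down: "?w * db \<theta> (l + 1/2) (m + 3/2) (n + 1/2)
      - db \<theta> (l + 1/2) (m + 1/2) (n + 1/2) * of_real (sqrt (l - m) * sqrt (l + m + 2)) = 0"
    unfolding d1 d2 mult.commute[of "sqrt (l - m)"] balanced_weight by simp
  have "coef (lower_op v) (l - 1/2, m + 1/2, n + 1/2, \<sigma>)
      = of_real (sqrt (l - m - 1) * sqrt (l + m + 1)) * coef v (l - 1/2, m + 3/2, n + 1/2, \<sigma>)"
    "coef (lower_op v) (l + 1/2, m + 1/2, n + 1/2, \<sigma>)
      = of_real (sqrt (l - m) * sqrt (l + m + 2)) * coef v (l + 1/2, m + 3/2, n + 1/2, \<sigma>)"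
    by (rule coef_lower_eq; simp)+
  moreover have "m + 1 + 1/2 = m + 3/2" by simp
  ultimately show "coef (comm lower_op (opb \<theta>) v) (l, m, n, \<sigma>) = coef (0 v) (l, m, n, \<sigma>)"
    unfolding comm_def oper_apply o_apply coef_diff coef_zero
    by (simp only: coef_lower[of _ l m n] coef_opb coef_comm_two_terms up down) simp
qed

section \<open>The Dirac operator\<close>

text \<open>The horizontal Dirac operator in ladder form: \<open>L\<^sub>+\<close> combined with the spin flip from \<open>+\<close> to \<open>-\<close>,
  and \<open>L\<^sub>-\<close> combined with the flip from \<open>-\<close> to \<open>+\<close>. As a function of the spin, the weight is that of
  the target.\<close>

definition hor_op :: "complex \<Rightarrow> oper" where
  "hor_op s = spin_op (\<lambda>\<sigma>. case \<sigma> of Plus \<Rightarrow> 0 | Minus \<Rightarrow> s) flip \<cdot> raise_op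
    + spin_op (\<lambda>\<sigma>. case \<sigma> of Plus \<Rightarrow> cnj s | Minus \<Rightarrow> 0) flip \<cdot> lower_op"

lemma coef_hor:
  "coef (hor_op s v) (l, m, n, Plus) =
    cnj s * (of_real (sqrt (l - m) * sqrt (l + m + 1)) * coef v (l, m + 1, n, Minus))"
  "coef (hor_op s v) (l, m, n, Minus) =
    s * (of_real (sqrt (l + m) * sqrt (l - m + 1)) * coef v (l, m - 1, n, Plus))"
  unfolding hor_op_def oper_apply o_apply coef_add coef_spin_op coef_raise coef_lower by simp_all

lemma lf_hor: "locally_finite (hor_op s)"
  unfolding hor_op_def
  by (intro lf_add lf_comp lf_spin_op lf_raise lf_lower flip_flip)

lemma adj_hor: "adj (hor_op s) = hor_op s"
proof -
  let ?E = "spin_op (\<lambda>\<sigma>. case \<sigma> of Plus \<Rightarrow> 0 | Minus \<Rightarrow> s) flip"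
  let ?F = "spin_op (\<lambda>\<sigma>. case \<sigma> of Plus \<Rightarrow> cnj s | Minus \<Rightarrow> 0) flip"
  have lf: "locally_finite ?E" "locally_finite ?F" by (intro lf_spin_op flip_flip)+
  have "adj ?E = ?F" "adj ?F = ?E"
    unfolding adj_spin_op[OF flip_flip]
    by (rule arg_cong[of _ _ "\<lambda>c. spin_op c flip"], rule ext, rename_tac \<sigma>, case_tac \<sigma>; simp)+
  then show ?thesis
    unfolding hor_op_def
    by (simp add: adj_add adj_comp lf lf_comp lf_raise lf_lower adj_raise adj_lower
        spin_op_raise[symmetric] spin_op_lower[symmetric] add.commute)
qed

lemma Gamma_hor: "\<Gamma>op \<cdot> hor_op s = - (hor_op s \<cdot> \<Gamma>op)"
proof (rule oper_eqI)
  fix v l m n \<sigma>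
  show "coef ((\<Gamma>op \<cdot> hor_op s) v) (l, m, n, \<sigma>) = coef ((- (hor_op s \<cdot> \<Gamma>op)) v) (l, m, n, \<sigma>)"
    by (cases \<sigma>) (simp_all add: coef_Gamma coef_hor coef_uminus)
qed

lemma Gamma_delta: "\<Gamma>op \<cdot> \<delta>op = \<delta>op \<cdot> \<Gamma>op"
  by (rule oper_eqI) (simp add: coef_Gamma coef_delta)

lemma dirac_eq:
  "dirac r \<alpha> s = hor_op s + of_real (r / 2) *\<^sub>O (\<Gamma>op \<cdot> \<delta>op) + of_real (\<alpha> / 4) *\<^sub>O id"
proof (rule oper_eqI)
  fix v l m n \<sigma>
  assume "(l, m, n, \<sigma>) \<in> range Rep_label"
  then obtain j where j: "Rep_label j = (l, m, n, \<sigma>)" by (metis imageE)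
  define K where "K = (\<lambda>l m n \<sigma>. case \<sigma> of
     Plus \<Rightarrow> (r * (m + 1/2) + \<alpha> / 4) *\<^sub>V ket l m n Plus
        + (s * (sqrt (l + 1 + m) * sqrt (l - m))) *\<^sub>V ket l (m + 1) n Minus
   | Minus \<Rightarrow> (- r * (m - 1/2) + \<alpha> / 4) *\<^sub>V ket l m n Minus
        + (cnj s * (sqrt (l - m + 1) * sqrt (l + m))) *\<^sub>V ket l (m - 1) n Plus)"
  have D: "coef (dirac r \<alpha> s v) (l, m, n, \<sigma>) = (\<Sum>i | image_of K i j \<noteq> 0. v i * image_of K i j)"
    unfolding dirac_def lin_ext_def K_def[symmetric] coef_Rep_label[OF j] ..
  show "coef (dirac r \<alpha> s v) (l, m, n, \<sigma>) =
    coef ((hor_op s + of_real (r / 2) *\<^sub>O (\<Gamma>op \<cdot> \<delta>op) + of_real (\<alpha> / 4) *\<^sub>O id) v) (l, m, n, \<sigma>)"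
  proof (cases \<sigma>)
    case Plus
    \<comment> \<open>The off-diagonal entry of row \<open>(l, m, n, +)\<close> comes from column \<open>(l, m + 1, n, -)\<close>.\<close>
    have row: "image_of K i j =
      (if Rep_label i = (l, m, n, Plus) then of_real (r * (m + 1/2) + \<alpha> / 4) else 0) +
      (if Rep_label i = (l, m + 1, n, Minus) then cnj s * of_real (sqrt (l - m) * sqrt (l + m + 1)) else 0)" for i
      using j Plus
      by (cases "Rep_label i") (auto simp: image_of_def K_def ket_def scaleV_def pointwise add.assoc split: spin.splits)
    show ?thesis
      unfolding D sum_two[OF row, simplified]
      by (simp add: Plus coef_add coef_scale coef_hor coef_Gamma coef_delta algebra_simps)
  next
    case Minus
    have row: "image_of K i j =
      (if Rep_label i = (l, m, n, Minus) then of_real (- r * (m - 1/2) + \<alpha> / 4) else 0) +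
      (if Rep_label i = (l, m - 1, n, Plus) then s * of_real (sqrt (l + m) * sqrt (l - m + 1)) else 0)" for i
      using j Minus
      by (cases "Rep_label i") (auto simp: image_of_def K_def ket_def scaleV_def pointwise diff_diff_eq2 add_ac split: spin.splits)
    show ?thesis
      unfolding D sum_two[OF row, simplified]
      by (simp add: Minus coef_add coef_scale coef_hor coef_Gamma coef_delta algebra_simps)
  qed
qed

lemma lf_dirac: "locally_finite (dirac r \<alpha> s)"
  unfolding dirac_eq by (intro lf_add lf_scale lf_comp lf_hor lf_Gamma lf_delta lf_id)

lemma Gamma_dirac_anticomm:
  "\<Gamma>op \<cdot> dirac r \<alpha> s + dirac r \<alpha> s \<cdot> \<Gamma>op = of_real r *\<^sub>O \<delta>op + of_real (\<alpha> / 2) *\<^sub>O \<Gamma>op"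
proof -
  have G: "\<Gamma>op \<cdot> (\<Gamma>op \<cdot> \<delta>op) = \<delta>op" "\<Gamma>op \<cdot> \<delta>op \<cdot> \<Gamma>op = \<delta>op"
    using Gamma_Gamma by (metis o_assoc id_comp Gamma_delta comp_id)+
  show ?thesis
    unfolding dirac_eq comp_distrib_left comp_distrib_right[OF lf_linear[OF lf_Gamma]] G Gamma_hor
    by (simp add: algebra_simps O.scale_left_distrib[symmetric])
qed

lemma dirac_hor_dirac: "dirac_hor (dirac r \<alpha> s) = hor_op s"
proof (rule oper_eqI)
  fix v l m n \<sigma>
  show "coef (dirac_hor (dirac r \<alpha> s) v) (l, m, n, \<sigma>) = coef (hor_op s v) (l, m, n, \<sigma>)"
    unfolding dirac_hor_def comm_def dirac_eq
    by (cases \<sigma>) (simp_all add: coef_simps coef_hor coef_Gamma coef_delta)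
qed

section \<open>The real structure\<close>

lemma coef_J: "coef (Jop v) (l, m, n, \<sigma>) =
  of_real (spin_sign (flip \<sigma>)) * cis (- (pi * (m + n))) * cnj (coef v (l, - m, - n, flip \<sigma>))"
proof (cases "(l, m, n, \<sigma>) \<in> range Rep_label")
  case True
  then obtain j where j: "Rep_label j = (l, m, n, \<sigma>)" by (metis imageE)
  have "image_of (\<lambda>l m n \<sigma>. (of_real (spin_sign \<sigma>) * cis (pi / 2 * (2 * (m + n)))) *\<^sub>V ket l (- m) (- n) (flip \<sigma>)) i j
     = (if Rep_label i = (l, - m, - n, flip \<sigma>) then of_real (spin_sign (flip \<sigma>)) * cis (- (pi * (m + n))) else 0)
       + (if Rep_label i = (l + 1, m, n, \<sigma>) then 0 else 0)" for i
    by (cases "Rep_label i") (auto simp: image_of_def ket_def scaleV_def j flip_flip algebra_simps)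
  from sum_two[OF this, of "\<lambda>i. cnj (v i)"] show ?thesis
    by (simp add: Jop_def antilin_ext_def coef_Rep_label[OF j] coef_cnj)
next
  case False
  then have "(l, - m, - n, flip \<sigma>) \<notin> range Rep_label" by (auto simp: range_Rep_label)
  with False show ?thesis by (simp add: coef_outside)
qed

lemma J_add: "Jop (u + v) = Jop u + Jop v"
  by (rule vec_eqI) (simp add: coef_J coef_add algebra_simps)

lemma J_scale: "Jop (c *\<^sub>V v) = cnj c *\<^sub>V Jop v"
  by (rule vec_eqI) (simp add: coef_J coef_scale algebra_simps)

text \<open>The square of \<open>J\<close> multiplies by \<open>-1\<close> from the two spin flips and by the phase \<open>i\<close> to the power \<open>-4 (m + n)\<close>,
  which is \<open>1\<close> as \<open>m + n\<close> is an integer.\<close>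

lemma J_J: "Jop (Jop v) = - v"
proof (rule vec_eqI)
  fix l m n \<sigma> assume "(l, m, n, \<sigma>) \<in> range Rep_label"
  then obtain a b where "l + m = of_nat a" "l - n = of_nat b"
    by (auto simp: range_Rep_label elim!: Nats_cases)
  then have "- (m + n) = of_int (int b - int a)" by simp
  then have "- (pi * (m + n)) + - (pi * (m + n)) = 2 * pi * of_int (int b - int a)"
    by (metis mult.commute mult_2 mult_minus_right mult.assoc)
  then have "cis (- (pi * (m + n))) * cis (- (pi * (m + n))) = cis (2 * pi * of_int (int b - int a))"
    unfolding cis_mult by (rule arg_cong)
  also have "\<dots> = 1" by (rule cis_multiple_2pi) auto
  finally have c: "cis (- (pi * (m + n))) * cis (- (pi * (m + n))) = 1" .
  have "coef (Jop (Jop v)) (l, m, n, \<sigma>)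
    = of_real (spin_sign (flip \<sigma>)) * of_real (spin_sign \<sigma>) *
      (cis (- (pi * (m + n))) * cis (- (pi * (m + n)))) * coef v (l, m, n, \<sigma>)"
    by (simp add: coef_J flip_flip cis_cnj algebra_simps)
  also have "\<dots> = coef (- v) (l, m, n, \<sigma>)"
    unfolding c by (cases \<sigma>) (simp_all add: coef_uminus)
  finally show "coef (Jop (Jop v)) (l, m, n, \<sigma>) = coef (- v) (l, m, n, \<sigma>)" .
qed

lemma J_minus: "Jop (- v) = - Jop v"
  using J_scale[of "-1" v] by simp

lemma J_diff: "Jop (u - v) = Jop u - Jop v"
  using J_add[of u "- v"] by (simp add: J_minus)

lemma J_sum: "Jop (\<Sum>i\<in>F. f i) = (\<Sum>i\<in>F. Jop (f i))"
proof (induction F rule: infinite_finite_induct)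
qed (use J_scale[of 0] in \<open>auto simp: J_add\<close>)

lemma inv_J: "inv Jop v = - Jop v"
proof -
  have "inj Jop" by (rule injI) (metis J_J minus_minus)
  moreover have "Jop (- Jop v) = v" by (simp add: J_minus J_J)
  ultimately show ?thesis by (metis inv_f_eq)
qed

lemma J_hor: "Jop (hor_op s v) = hor_op s (Jop v)"
proof (rule vec_eqI)
  fix l m n \<sigma>
  show "coef (Jop (hor_op s v)) (l, m, n, \<sigma>) = coef (hor_op s (Jop v)) (l, m, n, \<sigma>)"
  proof (cases \<sigma>)
    case Plus
    have "cis (- (pi * (m + 1 + n))) = - cis (- (pi * (m + n)))"
      by (simp add: complex_eq_iff distrib_left sin_add cos_add sin_diff cos_diff)
    moreover have "- m - 1 = - (m + 1)" by simp
    ultimately show ?thesis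
      unfolding Plus by (simp only: coef_J coef_hor flip.simps) (simp add: algebra_simps)
  next
    case Minus
    have "cis (- (pi * (m - 1 + n))) = - cis (- (pi * (m + n)))"
      by (simp add: complex_eq_iff distrib_left right_diff_distrib sin_add cos_add sin_diff cos_diff)
    moreover have "- m + 1 = - (m - 1)" by simp
    ultimately show ?thesis
      unfolding Minus by (simp only: coef_J coef_hor flip.simps) (simp add: algebra_simps)
  qed
qed

lemma J_delta: "Jop (\<delta>op v) = - \<delta>op (Jop v)"
proof (rule vec_eqI)
  fix l m n \<sigma>
  show "coef (Jop (\<delta>op v)) (l, m, n, \<sigma>) = coef (- \<delta>op (Jop v)) (l, m, n, \<sigma>)"
    by (cases \<sigma>) (simp_all add: coef_J coef_delta coef_uminus algebra_simps)
qed

lemma J_finsupp: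
  assumes "v \<in> finsupp"
  shows "Jop v \<in> finsupp"
  using assms
proof (induction rule: finsupp_induct)
  case zero
  then show ?case using J_scale[of 0 0] V.subspace_0[OF finsupp_subspace] by simp
next
  case (step c j y)
  obtain l m n \<sigma> where j: "Rep_label j = (l, m, n, \<sigma>)" by (cases "Rep_label j")
  have "{i. Jop (unit_vec j) i \<noteq> 0} \<subseteq> {i. Rep_label i = (l, - m, - n, flip \<sigma>)}"
  proof
    fix i assume i: "i \<in> {i. Jop (unit_vec j) i \<noteq> 0}"
    obtain l' m' n' \<sigma>' where Ri: "Rep_label i = (l', m', n', \<sigma>')" by (cases "Rep_label i")
    with i have "(l', - m', - n', flip \<sigma>') = Rep_label j"
      using coef_J[of "unit_vec j" l' m' n' \<sigma>'] coef_Rep_label[OF Ri, of "Jop (unit_vec j)"]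
      by (auto simp: coef_unit_vec split: if_splits)
    then show "i \<in> {i. Rep_label i = (l, - m, - n, flip \<sigma>)}" by (auto simp: Ri j flip_flip)
  qed
  then have "Jop (unit_vec j) \<in> finsupp"
    using finite_Rep_label finite_subset unfolding finsupp_def by blast
  then show ?case
    using step finsupp_subspace by (auto simp: J_add J_scale intro!: V.subspace_add V.subspace_scale)
qed

section \<open>The algebra\<close>

lemma sphere3_lf: "x \<in> sphere3 \<theta> \<Longrightarrow> locally_finite x"
  by (induction rule: sphere3.induct)
    (blast intro: lf_id lf_opa lf_opb lf_adj lf_scale lf_add lf_comp)+

lemma sphere3_linear: "x \<in> sphere3 \<theta> \<Longrightarrow> linear_oper x"
  by (intro lf_linear sphere3_lf)

lemma sphere3_zero: "0 \<in> sphere3 \<theta>"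
  using sphere3.intros(5)[OF sphere3.intros(1), of 0] by simp

text \<open>The algebra acts by the same formula on both spin components. The involution \<open>f\<close> makes the family of
  spin operators closed under adjoints, which the induction needs at \<open>adj x\<close>.\<close>

lemma sphere3_spin_op:
  assumes "x \<in> sphere3 \<theta>" and f: "\<And>\<sigma>. f (f \<sigma>) = \<sigma>"
  shows "x \<cdot> spin_op c f = spin_op c f \<cdot> x"
  using assms(1)
proof (induction arbitrary: c rule: sphere3.induct)
  case (4 x)
  let ?c = "\<lambda>\<sigma>. cnj (c (f \<sigma>))"
  have "adj (spin_op ?c f) = spin_op c f" by (simp add: adj_spin_op f)
  moreover have "adj (x \<cdot> spin_op ?c f) = adj (spin_op ?c f \<cdot> x)" by (simp only: 4)
  ultimately show ?case
    by (simp add: adj_comp sphere3_lf[OF 4(1)] lf_spin_op f)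
next
  case (5 x a)
  then show ?case
    by (simp only: comp_distrib_left comp_distrib_right[OF lf_linear[OF lf_spin_op[OF f]]])
next
  case (6 x y)
  then show ?case
    by (simp only: comp_distrib_left comp_distrib_right[OF lf_linear[OF lf_spin_op[OF f]]])
next
  case (7 x y)
  then show ?case by (metis comp_assoc)
qed (simp_all add: opa_spin_op opb_spin_op)

lemma sphere3_Gamma: "x \<in> sphere3 \<theta> \<Longrightarrow> x \<cdot> \<Gamma>op = \<Gamma>op \<cdot> x"
  unfolding Gamma_eq_spin_op by (rule sphere3_spin_op) auto

lemma comm_add_right:
  assumes "linear_oper S"
  shows "comm S (x + y) = comm S x + comm S y"
  by (simp add: comm_def comp_distrib_left comp_distrib_right[OF assms])

lemma comm_scale_right:
  assumes "linear_oper S"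
  shows "comm S (c *\<^sub>O x) = c *\<^sub>O comm S x"
  by (simp add: comm_def comp_distrib_left comp_distrib_right[OF assms] O.scale_right_diff_distrib)

lemma comm_zero_right:
  assumes "linear_oper S"
  shows "comm S 0 = 0"
  by (simp add: comm_def comp_distrib_left comp_distrib_right[OF assms])

lemma comm_id: "comm S id = 0"
  by (simp add: comm_def)

lemma comm_adj:
  assumes "locally_finite S" "locally_finite T"
  shows "comm (adj S) (adj T) = - adj (comm S T)"
  by (simp add: comm_def adj_diff adj_comp lf_comp assms)

subsection \<open>The two partitions of unity\<close>

lemma lower_adj_opa: "comm lower_op (adj (opa \<theta>)) = 0"
  using comm_adj[OF lf_raise lf_opa, of \<theta>] by (simp add: adj_raise comm_raise_opa adj_zero)

lemma raise_adj_opa: "comm raise_op (adj (opa \<theta>)) = - adj (opb (- \<theta>))"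
  using comm_adj[OF lf_lower lf_opa, of \<theta>] by (simp add: adj_lower comm_lower_opa)

lemma raise_adj_opb: "comm raise_op (adj (opb \<theta>)) = 0"
  using comm_adj[OF lf_lower lf_opb, of \<theta>] by (simp add: adj_lower comm_lower_opb adj_zero)

lemma lower_adj_opb: "comm lower_op (adj (opb \<theta>)) = - adj (opa (- \<theta>))"
  using comm_adj[OF lf_raise lf_opb, of \<theta>] by (simp add: adj_raise comm_raise_opb)

text \<open>Commute \<open>a\<^sup>* a + b b\<^sup>* = 1\<close> with \<open>L\<^sub>-\<close>, which commutes with \<open>a\<^sup>*\<close> and \<open>b\<close>.\<close>

lemma lower_unit_relation:
  "adj (opa \<theta>) \<cdot> comm lower_op (opa \<theta>) + opb \<theta> \<cdot> comm lower_op (adj (opb \<theta>)) = 0"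
proof -
  have "comm lower_op (adj (opa \<theta>) \<cdot> opa \<theta> + opb \<theta> \<cdot> adj (opb \<theta>)) = 0"
    unfolding opa_opb_unit_relation by (rule comm_id)
  then show ?thesis
    by (simp add: comm_add_right[OF lf_linear[OF lf_lower]] comm_comp[OF lf_linear[OF lf_adj[OF lf_opa]]]
        comm_comp[OF lf_linear[OF lf_opb]] lower_adj_opa comm_lower_opb comp_distrib_left)
qed

text \<open>The flatness relation \<open>a\<^sup>* [L\<^sub>-, a] + b [L\<^sub>-, b\<^sup>*] = 0\<close> says that \<open>a\<^sup>* b' = b a'\<^sup>*\<close>, where the prime
  reverses the sign of \<open>\<theta>\<close>. Commuting it with \<open>L\<^sub>+\<close> gives \<open>a\<^sup>* a - b'\<^sup>* b' = a' a'\<^sup>* - b b\<^sup>*\<close>, which turns the known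
  relation for \<open>\<theta>\<close> into the new one for \<open>-\<theta>\<close>.\<close>

lemma opa_opb_unit_relation':
  "opa \<theta> \<cdot> adj (opa \<theta>) + adj (opb \<theta>) \<cdot> opb \<theta> = id"
proof -
  let ?a = "opa \<theta>" and ?b = "opb \<theta>" and ?a' = "opa (- \<theta>)" and ?b' = "opb (- \<theta>)"
  note lin = lf_linear[OF lf_raise] lf_linear[OF lf_adj[OF lf_opa]] lf_linear[OF lf_opb]
  have "adj ?a' \<cdot> ?b - ?b' \<cdot> adj ?a = 0"
    using lower_unit_relation[of "- \<theta>"]
    by (simp add: comm_lower_opa lower_adj_opb comp_distrib_right[OF lin(3)])
  then have "comm raise_op (adj ?a' \<cdot> ?b) = comm raise_op (?b' \<cdot> adj ?a)" by simp
  then have "adj ?a' \<cdot> ?a' - adj ?b \<cdot> ?b = ?a \<cdot> adj ?a - ?b' \<cdot> adj ?b'"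
    by (simp add: comm_comp lin raise_adj_opa comm_raise_opb comp_distrib_left
        comp_distrib_right[OF lin(2)] comp_distrib_right[OF lin(3)])
  then have "?a \<cdot> adj ?a + adj ?b \<cdot> ?b = adj ?a' \<cdot> ?a' + ?b' \<cdot> adj ?b'"
    by (simp add: algebra_simps)
  then show ?thesis unfolding opa_opb_unit_relation .
qed

lemma raise_unit_relation':
  "opa \<theta> \<cdot> comm raise_op (adj (opa \<theta>)) + adj (opb \<theta>) \<cdot> comm raise_op (opb \<theta>) = 0"
proof -
  have "comm raise_op (opa \<theta> \<cdot> adj (opa \<theta>) + adj (opb \<theta>) \<cdot> opb \<theta>) = 0"
    unfolding opa_opb_unit_relation' by (rule comm_id)
  then show ?thesis
    by (simp add: comm_add_right[OF lf_linear[OF lf_raise]] comm_comp[OF lf_linear[OF lf_opa]]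
        comm_comp[OF lf_linear[OF lf_adj[OF lf_opb]]] raise_adj_opb comm_raise_opa comp_distrib_left)
qed

lemma comm_hor:
  assumes "x \<in> sphere3 \<theta>"
  shows "comm (hor_op s) x = spin_op (\<lambda>\<sigma>. case \<sigma> of Plus \<Rightarrow> 0 | Minus \<Rightarrow> s) flip \<cdot> comm raise_op x
    + spin_op (\<lambda>\<sigma>. case \<sigma> of Plus \<Rightarrow> cnj s | Minus \<Rightarrow> 0) flip \<cdot> comm lower_op x"
proof -
  let ?E = "spin_op (\<lambda>\<sigma>. case \<sigma> of Plus \<Rightarrow> 0 | Minus \<Rightarrow> s) flip"
  let ?F = "spin_op (\<lambda>\<sigma>. case \<sigma> of Plus \<Rightarrow> cnj s | Minus \<Rightarrow> 0) flip"
  have "linear_oper ?E" "linear_oper ?F" by (intro lf_linear lf_spin_op flip_flip)+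
  then show ?thesis
    using sphere3_spin_op[OF assms flip_flip]
    by (simp add: comm_def hor_op_def comp_distrib_left comp_distrib_right sphere3_linear[OF assms] o_assoc)
qed

text \<open>Flatness for the two ladder operators implies flatness for \<open>H\<close>, since the spin flips in \<open>H\<close> can
  be pulled out to the left of the algebra.\<close>

lemma hor_flat:
  assumes A: "u1 \<in> sphere3 \<theta>" "v1 \<in> sphere3 \<theta>" "u2 \<in> sphere3 \<theta>" "v2 \<in> sphere3 \<theta>"
    and raise: "u1 \<cdot> comm raise_op v1 + u2 \<cdot> comm raise_op v2 = 0"
    and lower: "u1 \<cdot> comm lower_op v1 + u2 \<cdot> comm lower_op v2 = 0"
  shows "u1 \<cdot> comm (hor_op s) v1 + u2 \<cdot> comm (hor_op s) v2 = 0"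
proof -
  let ?E = "spin_op (\<lambda>\<sigma>. case \<sigma> of Plus \<Rightarrow> 0 | Minus \<Rightarrow> s) flip"
  let ?F = "spin_op (\<lambda>\<sigma>. case \<sigma> of Plus \<Rightarrow> cnj s | Minus \<Rightarrow> 0) flip"
  have lin: "linear_oper ?E" "linear_oper ?F" by (intro lf_linear lf_spin_op flip_flip)+
  have u: "u \<cdot> comm (hor_op s) v = ?E \<cdot> (u \<cdot> comm raise_op v) + ?F \<cdot> (u \<cdot> comm lower_op v)"
    if "u \<in> sphere3 \<theta>" "v \<in> sphere3 \<theta>" for u v
    using sphere3_spin_op[OF that(1) flip_flip]
    by (simp add: comm_hor[OF that(2)] comp_distrib_right[OF sphere3_linear[OF that(1)]] o_assoc)
  have "u1 \<cdot> comm (hor_op s) v1 + u2 \<cdot> comm (hor_op s) v2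
      = ?E \<cdot> (u1 \<cdot> comm raise_op v1 + u2 \<cdot> comm raise_op v2)
        + ?F \<cdot> (u1 \<cdot> comm lower_op v1 + u2 \<cdot> comm lower_op v2)"
    unfolding comp_distrib_right[OF lin(1)] comp_distrib_right[OF lin(2)] u[OF A(1,2)] u[OF A(3,4)]
    by (simp add: algebra_simps)
  also have "\<dots> = 0"
    unfolding raise lower comp_distrib_right(5)[OF lin(1)] comp_distrib_right(5)[OF lin(2)] by simp
  finally show ?thesis .
qed

lemma hor_unit_relation:
  "adj (opa \<theta>) \<cdot> comm (hor_op s) (opa \<theta>) + opb \<theta> \<cdot> comm (hor_op s) (adj (opb \<theta>)) = 0"
proof (rule hor_flat[where \<theta> = \<theta>])
  show "adj (opa \<theta>) \<cdot> comm raise_op (opa \<theta>) + opb \<theta> \<cdot> comm raise_op (adj (opb \<theta>)) = 0"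
    by (simp add: comm_raise_opa raise_adj_opb comp_distrib_right lf_linear lf_adj lf_opa lf_opb)
qed (intro lower_unit_relation sphere3.intros)+

lemma hor_unit_relation':
  "opa \<theta> \<cdot> comm (hor_op s) (adj (opa \<theta>)) + adj (opb \<theta>) \<cdot> comm (hor_op s) (opb \<theta>) = 0"
proof (rule hor_flat[where \<theta> = \<theta>])
  show "opa \<theta> \<cdot> comm lower_op (adj (opa \<theta>)) + adj (opb \<theta>) \<cdot> comm lower_op (opb \<theta>) = 0"
    by (simp add: comm_lower_opb lower_adj_opa comp_distrib_right lf_linear lf_adj lf_opa lf_opb)
qed (intro raise_unit_relation' sphere3.intros)+

subsection \<open>The grading\<close>

lemma alg_deg_mult:
  assumes "x \<in> alg_deg (sphere3 \<theta>) k" "y \<in> alg_deg (sphere3 \<theta>) l"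
  shows "x \<cdot> y \<in> alg_deg (sphere3 \<theta>) (k + l)"
proof -
  have A: "x \<in> sphere3 \<theta>" "y \<in> sphere3 \<theta>" using assms by (auto simp: alg_deg_def)
  have "comm \<delta>op (x \<cdot> y) = of_int (k + l) *\<^sub>O (x \<cdot> y)"
    using assms
    by (simp add: alg_deg_def comm_comp[OF sphere3_linear[OF A(1)]] comp_distrib_left
        comp_distrib_right[OF sphere3_linear[OF A(1)]] O.scale_left_distrib)
  then show ?thesis using A by (auto simp: alg_deg_def intro: sphere3.intros)
qed

lemma alg_deg_adj:
  assumes "x \<in> alg_deg (sphere3 \<theta>) k"
  shows "adj x \<in> alg_deg (sphere3 \<theta>) (- k)"
proof -
  have A: "x \<in> sphere3 \<theta>" using assms by (auto simp: alg_deg_def)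
  have "comm \<delta>op (adj x) = - adj (comm \<delta>op x)"
    using comm_adj[OF lf_delta sphere3_lf[OF A]] by (simp add: adj_delta)
  also have "\<dots> = of_int (- k) *\<^sub>O adj x"
    using assms by (simp add: alg_deg_def adj_scale)
  finally show ?thesis using A by (auto simp: alg_deg_def intro: sphere3.intros)
qed

lemma alg_deg_id: "id \<in> alg_deg (sphere3 \<theta>) 0"
  by (simp add: alg_deg_def comm_id sphere3.intros)

lemma alg_deg_opa: "opa \<theta> \<in> alg_deg (sphere3 \<theta>) 1"
  by (simp add: alg_deg_def delta_opa sphere3.intros)

lemma alg_deg_adj_opb: "adj (opb \<theta>) \<in> alg_deg (sphere3 \<theta>) 1"
  by (simp add: alg_deg_def delta_adj_opb sphere3.intros)

lemma alg_deg_opb: "opb \<theta> \<in> alg_deg (sphere3 \<theta>) (- 1)"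
proof -
  have "comm \<delta>op (opb \<theta>) = - opb \<theta>"
  proof (intro ext)
    fix v j
    obtain l m n \<sigma> where j: "Rep_label j = (l, m, n, \<sigma>)" by (cases "Rep_label j")
    show "comm \<delta>op (opb \<theta>) v j = (- opb \<theta>) v j"
      by (simp add: comm_def pointwise delta_apply[OF j] genB.val[OF j, folded opb_def] coef_delta)
        (simp add: algebra_simps)
  qed
  then show ?thesis by (simp add: alg_deg_def sphere3.intros)
qed

lemma alg_deg_sphere3: "x \<in> alg_deg (sphere3 \<theta>) k \<Longrightarrow> x \<in> sphere3 \<theta>"
  by (simp add: alg_deg_def)

text \<open>The generators are homogeneous, and products and adjoints of homogeneous elements are
  homogeneous.\<close>

lemma sphere3_homogeneous:
  assumes "x \<in> sphere3 \<theta>"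
  shows "x \<in> O.span (\<Union>k. alg_deg (sphere3 \<theta>) k)" (is "_ \<in> O.span ?G")
  using assms
proof (induction rule: sphere3.induct)
  case (4 x)
  have "adj x \<in> O.span ?G \<and> x \<in> sphere3 \<theta>"
    using 4(2)
  proof (induction rule: O.span_induct_alt)
    case base
    show ?case unfolding adj_zero using O.span_zero sphere3_zero by blast
  next
    case (step c x y)
    then have x: "x \<in> sphere3 \<theta>" "adj x \<in> O.span ?G" and y: "adj y \<in> O.span ?G" "y \<in> sphere3 \<theta>"
      by (blast intro: O.span_base alg_deg_adj alg_deg_sphere3)+
    have "adj (c *\<^sub>O x + y) = cnj c *\<^sub>O adj x + adj y"
      unfolding adj_add[OF lf_scale[OF sphere3_lf[OF x(1)]] sphere3_lf[OF y(2)]] adj_scale ..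
    then show ?case
      using O.span_add[OF O.span_scale[OF x(2)] y(1)] sphere3.intros(5,6) x(1) y(2) by metis
  qed
  then show ?case by (rule conjunct1)
next
  case (7 x y)
  have y: "z \<cdot> y \<in> O.span ?G" if z: "z \<in> ?G" for z
  proof -
    have lin: "linear_oper z" using z by (blast intro: sphere3_linear alg_deg_sphere3)
    show ?thesis
      using 7(4)
    proof (induction rule: O.span_induct_alt)
      case base
      show ?case unfolding comp_distrib_right(5)[OF lin] by (rule O.span_zero)
    next
      case (step c x w)
      have "z \<cdot> x \<in> ?G" using z step(1) by (blast intro: alg_deg_mult)
      then show ?case
        unfolding comp_distrib_right[OF lin] by (intro O.span_add O.span_scale O.span_base step(2))
    qed
  qed
  show ?case
    using 7(3)
  proof (induction rule: O.span_induct_alt)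
    case base
    show ?case unfolding comp_distrib_left by (rule O.span_zero)
  next
    case (step c x z)
    show ?case
      unfolding comp_distrib_left by (intro O.span_add O.span_scale step(2) y[OF step(1)])
  qed
qed (use alg_deg_id alg_deg_opa alg_deg_opb in \<open>blast intro: O.span_base O.span_add O.span_scale\<close>)+

text \<open>The two partitions of unity in a form that treats positive and negative degrees alike.
  Multiplying by an entry of \<open>u\<close> lowers the degree by \<open>\<epsilon>\<close>.\<close>

lemma flat_partition:
  assumes "\<epsilon> = 1 \<or> \<epsilon> = - 1"
  obtains u1 v1 u2 v2 where
    "u1 \<in> alg_deg (sphere3 \<theta>) (- \<epsilon>)" "u2 \<in> alg_deg (sphere3 \<theta>) (- \<epsilon>)"
    "v1 \<in> alg_deg (sphere3 \<theta>) \<epsilon>" "v2 \<in> alg_deg (sphere3 \<theta>) \<epsilon>"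
    "u1 \<cdot> v1 + u2 \<cdot> v2 = id"
    "u1 \<cdot> comm (hor_op s) v1 + u2 \<cdot> comm (hor_op s) v2 = 0"
  using assms
proof
  assume "\<epsilon> = 1"
  then show thesis
    using that[of "adj (opa \<theta>)" "opb \<theta>" "opa \<theta>" "adj (opb \<theta>)"] alg_deg_opa alg_deg_opb
      alg_deg_adj_opb alg_deg_adj[OF alg_deg_opa] opa_opb_unit_relation hor_unit_relation
    by simp
next
  assume "\<epsilon> = - 1"
  then show thesis
    using that[of "opa \<theta>" "adj (opb \<theta>)" "adj (opa \<theta>)" "opb \<theta>"] alg_deg_opa alg_deg_opb
      alg_deg_adj_opb alg_deg_adj[OF alg_deg_opa] opa_opb_unit_relation' hor_unit_relation'
    by simp
qed

section \<open>The strong connection\<close>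

text \<open>The commutator with \<open>\<Gamma> \<delta>\<close> is \<open>\<Gamma> \<delta>(x)\<close>, as \<open>x\<close> commutes with \<open>\<Gamma>\<close>.\<close>

lemma comm_dirac:
  assumes "x \<in> sphere3 \<theta>"
  shows "comm (dirac r \<alpha> s) x = comm (hor_op s) x + of_real (r / 2) *\<^sub>O (\<Gamma>op \<cdot> comm \<delta>op x)"
proof -
  have "x \<cdot> (\<Gamma>op \<cdot> \<delta>op) = \<Gamma>op \<cdot> (x \<cdot> \<delta>op)"
    using sphere3_Gamma[OF assms] by (metis comp_assoc)
  then show ?thesis
    unfolding comm_def dirac_eq comp_distrib_left comp_distrib_right[OF sphere3_linear[OF assms]]
      comp_distrib_right[OF lf_linear[OF lf_Gamma]] O.scale_right_diff_distrib id_comp comp_id comp_assoc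
    by (simp only: algebra_simps)
qed

lemma omega_eq: "omega \<theta> (dirac r \<alpha> s) = of_real (r / 2) *\<^sub>O \<Gamma>op"
proof -
  let ?a = "opa \<theta>" and ?b = "opb \<theta>"
  have A: "?a \<in> sphere3 \<theta>" "adj ?a \<in> sphere3 \<theta>" "?b \<in> sphere3 \<theta>" "adj ?b \<in> sphere3 \<theta>"
    by (intro sphere3.intros)+
  have G: "u \<cdot> (\<Gamma>op \<cdot> v) = \<Gamma>op \<cdot> (u \<cdot> v)" if "u \<in> sphere3 \<theta>" for u v
    using sphere3_Gamma[OF that] by (metis comp_assoc)
  have "omega \<theta> (dirac r \<alpha> s) =
      (adj ?a \<cdot> comm (hor_op s) ?a + ?b \<cdot> comm (hor_op s) (adj ?b))
      + of_real (r / 2) *\<^sub>O (\<Gamma>op \<cdot> (adj ?a \<cdot> ?a + ?b \<cdot> adj ?b))"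
    unfolding omega_def comm_dirac[OF A(1)] comm_dirac[OF A(4)] delta_opa delta_adj_opb
      comp_distrib_right[OF sphere3_linear[OF A(2)]] comp_distrib_right[OF sphere3_linear[OF A(3)]]
      comp_distrib_right[OF lf_linear[OF lf_Gamma]] G[OF A(2)] G[OF A(3)] O.scale_right_distrib
    by (simp only: add_ac)
  also have "\<dots> = of_real (r / 2) *\<^sub>O \<Gamma>op"
    unfolding hor_unit_relation opa_opb_unit_relation by simp
  finally show ?thesis .
qed

lemma nabla_eq:
  assumes "x \<in> sphere3 \<theta>"
  shows "nabla (dirac r \<alpha> s) (omega \<theta> (dirac r \<alpha> s)) x = comm (hor_op s) x"
proof -
  have lin: "linear_oper (comm \<delta>op x)"
    by (intro lf_linear lf_comm lf_delta sphere3_lf[OF assms])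
  have "comm \<delta>op x \<cdot> \<Gamma>op = \<Gamma>op \<cdot> comm \<delta>op x"
    unfolding comm_def comp_distrib_left comp_distrib_right[OF lf_linear[OF lf_Gamma]]
    using sphere3_Gamma[OF assms] Gamma_delta by (metis comp_assoc)
  then show ?thesis
    unfolding nabla_def omega_eq comm_dirac[OF assms] comp_distrib_right[OF lin] by simp
qed

lemma comm_delta_omega: "comm \<delta>op (omega \<theta> (dirac r \<alpha> s)) = 0"
  unfolding omega_eq comm_def comp_distrib_left comp_distrib_right[OF lf_linear[OF lf_delta]] Gamma_delta
  by simp

lemma one_forms_subspace: "O.subspace (one_forms D A)"
  unfolding one_forms_def by (rule O.subspace_span)

lemma one_formsI: "x' \<in> A \<Longrightarrow> x \<in> A \<Longrightarrow> x' \<cdot> comm D x \<in> one_forms D A"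
  unfolding one_forms_def by (rule O.span_base) blast

lemma omega_one_form: "omega \<theta> D \<in> one_forms D (sphere3 \<theta>)"
  unfolding omega_def
  by (intro O.subspace_add[OF one_forms_subspace] one_formsI sphere3.intros)

text \<open>Since \<open>\<Gamma>\<close> commutes with \<open>p\<close> and \<open>q\<close>, the left-hand side is \<open>p [\<Gamma> D + D \<Gamma>, q]\<close>. It depends on the
  operator \<open>p [D, q]\<close> alone, and so the right-hand side does not depend on the way in which a one-form is
  written; this is the vertical field condition.\<close>

lemma Gamma_anticomm_form:
  assumes "p \<in> sphere3 \<theta>" "q \<in> sphere3 \<theta>"
  shows "\<Gamma>op \<cdot> (p \<cdot> comm (dirac r \<alpha> s) q) + p \<cdot> comm (dirac r \<alpha> s) q \<cdot> \<Gamma>op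
    = of_real r *\<^sub>O (p \<cdot> comm \<delta>op q)"
proof -
  let ?D = "dirac r \<alpha> s"
  have "\<Gamma>op \<cdot> (p \<cdot> comm ?D q) + p \<cdot> comm ?D q \<cdot> \<Gamma>op = p \<cdot> comm (\<Gamma>op \<cdot> ?D + ?D \<cdot> \<Gamma>op) q"
  proof -
    have "\<Gamma>op \<cdot> (p \<cdot> comm ?D q) = p \<cdot> (\<Gamma>op \<cdot> comm ?D q)"
      using sphere3_Gamma[OF assms(1)] by (metis comp_assoc)
    moreover have "\<Gamma>op \<cdot> comm ?D q + comm ?D q \<cdot> \<Gamma>op = comm (\<Gamma>op \<cdot> ?D + ?D \<cdot> \<Gamma>op) q"
    proof -
      have "\<Gamma>op \<cdot> (q \<cdot> ?D) = q \<cdot> (\<Gamma>op \<cdot> ?D)" "?D \<cdot> (q \<cdot> \<Gamma>op) = ?D \<cdot> (\<Gamma>op \<cdot> q)"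
        using sphere3_Gamma[OF assms(2)] by (metis comp_assoc)+
      then show ?thesis
        unfolding comm_def comp_distrib_left comp_distrib_right[OF lf_linear[OF lf_Gamma]]
          comp_distrib_right[OF sphere3_linear[OF assms(2)]] comp_assoc
        by (simp only: algebra_simps)
    qed
    ultimately show ?thesis
      by (metis comp_assoc comp_distrib_right(1)[OF sphere3_linear[OF assms(1)]])
  qed
  also have "comm (\<Gamma>op \<cdot> ?D + ?D \<cdot> \<Gamma>op) q = of_real r *\<^sub>O comm \<delta>op q"
    unfolding Gamma_dirac_anticomm comm_def comp_distrib_left
      comp_distrib_right[OF sphere3_linear[OF assms(2)]] sphere3_Gamma[OF assms(2)]
    by (simp add: O.scale_right_diff_distrib)
  finally show ?thesis
    unfolding comp_distrib_right(4)[OF sphere3_linear[OF assms(1)]] .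
qed

lemma vertical_field_omega:
  assumes "r \<noteq> 0"
  shows "vertical_field (dirac r \<alpha> s) (sphere3 \<theta>) (omega \<theta> (dirac r \<alpha> s))"
  unfolding vertical_field_def
proof (intro allI impI, elim conjE)
  fix N and p q :: "nat \<Rightarrow> oper"
  let ?D = "dirac r \<alpha> s"
  assume pq: "\<forall>i<N. p i \<in> sphere3 \<theta> \<and> q i \<in> sphere3 \<theta>"
    and om: "omega \<theta> ?D = (\<Sum>i<N. p i \<cdot> comm ?D (q i))"
  have "of_real r *\<^sub>O (\<Sum>i<N. p i \<cdot> comm \<delta>op (q i))
      = (\<Sum>i<N. \<Gamma>op \<cdot> (p i \<cdot> comm ?D (q i)) + p i \<cdot> comm ?D (q i) \<cdot> \<Gamma>op)"
    unfolding O.scale_sum_right by (rule sum.cong) (use pq Gamma_anticomm_form in auto)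
  also have "\<dots> = \<Gamma>op \<cdot> omega \<theta> ?D + omega \<theta> ?D \<cdot> \<Gamma>op"
    unfolding om comp_sum_left comp_sum_right[OF lf_linear[OF lf_Gamma]] sum.distrib ..
  also have "\<dots> = of_real r *\<^sub>O id"
    unfolding omega_eq comp_distrib_left comp_distrib_right[OF lf_linear[OF lf_Gamma]] Gamma_Gamma
      O.scale_left_distrib[symmetric] of_real_add[symmetric] by simp
  finally show "(\<Sum>i<N. p i \<cdot> comm \<delta>op (q i)) = id"
    using assms by (simp only: O.scale_cancel_left of_real_eq_0_iff) simp
qed

lemma hor_forms_subspace: "O.subspace (hor_forms D A)"
  unfolding hor_forms_def by (rule O.subspace_span)

lemma hor_forms_right:
  assumes "z \<in> hor_forms D (sphere3 \<theta>)" "y \<in> sphere3 \<theta>"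
  shows "z \<cdot> y \<in> hor_forms D (sphere3 \<theta>)"
  using assms(1) unfolding hor_forms_def
proof (induction rule: O.span_induct_alt)
  case base
  then show ?case unfolding comp_distrib_left by (rule O.span_zero)
next
  case (step c x z)
  then obtain \<eta> x' where x: "x = \<eta> \<cdot> x'" "\<eta> \<in> one_forms D (invariants (sphere3 \<theta>))" "x' \<in> sphere3 \<theta>"
    by blast
  then have "x \<cdot> y = \<eta> \<cdot> (x' \<cdot> y)" "x' \<cdot> y \<in> sphere3 \<theta>"
    using assms(2) by (auto simp: comp_assoc intro: sphere3.intros)
  then have "x \<cdot> y \<in> O.span {\<eta> \<cdot> x |\<eta> x. \<eta> \<in> one_forms D (invariants (sphere3 \<theta>)) \<and> x \<in> sphere3 \<theta>}"
    using x(2) by (intro O.span_base) blast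
  then show ?case
    using step(2) unfolding comp_distrib_left by (intro O.span_add O.span_scale)
qed

text \<open>In degree \<open>0\<close> the commutator is that with \<open>D\<close>. Otherwise
  \<open>[H, x] = \<Sum> [H, (x u\<^sub>i) v\<^sub>i] = \<Sum> [H, x u\<^sub>i] v\<^sub>i + x \<Sum> u\<^sub>i [H, v\<^sub>i]\<close>, the last sum vanishes, and \<open>x u\<^sub>i\<close> has
  degree closer to \<open>0\<close>.\<close>

lemma hor_form_homogeneous:
  assumes "x \<in> alg_deg (sphere3 \<theta>) k"
  shows "comm (hor_op s) x \<in> hor_forms (dirac r \<alpha> s) (sphere3 \<theta>)"
  using assms
proof (induction "nat \<bar>k\<bar>" arbitrary: x k)
  case 0
  let ?D = "dirac r \<alpha> s"
  from 0 have x: "x \<in> invariants (sphere3 \<theta>)" by simp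
  then have "comm \<delta>op x = 0" by (simp add: alg_deg_def)
  then have D: "comm ?D x = comm (hor_op s) x"
    using comm_dirac[OF alg_deg_sphere3[OF x], of r \<alpha> s] comp_distrib_right(5)[OF lf_linear[OF lf_Gamma]]
    by simp
  have "id \<cdot> comm ?D x \<in> one_forms ?D (invariants (sphere3 \<theta>))"
    by (intro one_formsI alg_deg_id x)
  then have "(id \<cdot> comm ?D x) \<cdot> id \<in> hor_forms ?D (sphere3 \<theta>)"
    unfolding hor_forms_def using sphere3.intros(1) by (intro O.span_base) blast
  then show ?case unfolding D by simp
next
  case (Suc n)
  let ?H = "hor_op s"
  have "sgn k = 1 \<or> sgn k = - 1" using Suc(2) by (auto simp: sgn_if)
  then obtain u1 v1 u2 v2 where u: "u1 \<in> alg_deg (sphere3 \<theta>) (- sgn k)" "u2 \<in> alg_deg (sphere3 \<theta>) (- sgn k)"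
    and v: "v1 \<in> alg_deg (sphere3 \<theta>) (sgn k)" "v2 \<in> alg_deg (sphere3 \<theta>) (sgn k)"
    and unit: "u1 \<cdot> v1 + u2 \<cdot> v2 = id"
    and flat: "u1 \<cdot> comm ?H v1 + u2 \<cdot> comm ?H v2 = 0"
    by (rule flat_partition)
  note A = alg_deg_sphere3[OF Suc(3)] u[THEN alg_deg_sphere3] v[THEN alg_deg_sphere3]
  have n: "n = nat \<bar>k + - sgn k\<bar>" using Suc(2) by (auto simp: sgn_if)
  have IH: "comm ?H (x \<cdot> u) \<cdot> v \<in> hor_forms (dirac r \<alpha> s) (sphere3 \<theta>)"
    if "u \<in> alg_deg (sphere3 \<theta>) (- sgn k)" "v \<in> sphere3 \<theta>" for u v
    using Suc(1)[OF n alg_deg_mult[OF Suc(3) that(1)]] that(2) by (rule hor_forms_right)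
  have "x = x \<cdot> (u1 \<cdot> v1 + u2 \<cdot> v2)" unfolding unit by simp
  also have "\<dots> = (x \<cdot> u1) \<cdot> v1 + (x \<cdot> u2) \<cdot> v2"
    by (simp only: comp_distrib_right[OF sphere3_linear[OF A(1)]] comp_assoc)
  finally have x: "x = (x \<cdot> u1) \<cdot> v1 + (x \<cdot> u2) \<cdot> v2" .
  have lin: "linear_oper (x \<cdot> u1)" "linear_oper (x \<cdot> u2)"
    using A by (auto intro!: sphere3_linear sphere3.intros)
  have "comm ?H x = comm ?H ((x \<cdot> u1) \<cdot> v1 + (x \<cdot> u2) \<cdot> v2)" by (subst x) (rule refl)
  also have "\<dots> = (comm ?H (x \<cdot> u1) \<cdot> v1 + comm ?H (x \<cdot> u2) \<cdot> v2)
      + x \<cdot> (u1 \<cdot> comm ?H v1 + u2 \<cdot> comm ?H v2)"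
    unfolding comm_add_right[OF lf_linear[OF lf_hor]] comm_comp[OF lin(1)] comm_comp[OF lin(2)]
    unfolding comp_distrib_right[OF sphere3_linear[OF A(1)]] comp_assoc
    by (simp only: add_ac)
  also have "\<dots> = comm ?H (x \<cdot> u1) \<cdot> v1 + comm ?H (x \<cdot> u2) \<cdot> v2"
    unfolding flat comp_distrib_right(5)[OF sphere3_linear[OF A(1)]] by simp
  also have "\<dots> \<in> hor_forms (dirac r \<alpha> s) (sphere3 \<theta>)"
    by (intro O.subspace_add[OF hor_forms_subspace] IH u A)
  finally show ?case .
qed

lemma hor_form:
  assumes "x \<in> sphere3 \<theta>"
  shows "comm (hor_op s) x \<in> hor_forms (dirac r \<alpha> s) (sphere3 \<theta>)"
  using sphere3_homogeneous[OF assms]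
proof (induction rule: O.span_induct_alt)
  case base
  show ?case
    unfolding comm_zero_right[OF lf_linear[OF lf_hor]] by (rule O.subspace_0[OF hor_forms_subspace])
next
  case (step c x y)
  then obtain k where "x \<in> alg_deg (sphere3 \<theta>) k" by blast
  then have "comm (hor_op s) x \<in> hor_forms (dirac r \<alpha> s) (sphere3 \<theta>)"
    by (rule hor_form_homogeneous)
  then show ?case
    using step(2)
    unfolding comm_add_right[OF lf_linear[OF lf_hor]] comm_scale_right[OF lf_linear[OF lf_hor]]
    by (intro O.subspace_add[OF hor_forms_subspace] O.subspace_scale[OF hor_forms_subspace])
qed

lemma strong_connection_omega:
  assumes "r \<noteq> 0"
  shows "strong_connection (dirac r \<alpha> s) (sphere3 \<theta>) (omega \<theta> (dirac r \<alpha> s))"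
  unfolding strong_connection_def
  using omega_one_form comm_delta_omega vertical_field_omega[OF assms] nabla_eq hor_form by metis

section \<open>The twisted operator\<close>

lemma right_act_eq: "right_act h x = - Jop (adj x (Jop h))"
  unfolding right_act_def inv_J VV.linear_neg[OF adj_linear] J_minus ..

lemma right_form_eq: "right_form h \<eta> = Jop (adj \<eta> (Jop h))"
  unfolding right_form_def inv_J VV.linear_neg[OF adj_linear] J_minus minus_minus ..

lemma right_act_comp:
  assumes "locally_finite x" "locally_finite y"
  shows "right_act (right_act h x) y = right_act h (x \<cdot> y)"
  unfolding right_act_eq J_minus J_J minus_minus adj_comp[OF assms] o_apply ..

text \<open>The right action of \<open>\<eta>\<close> followed by that of \<open>y\<close> sees only the product \<open>\<eta> y\<close>. Consequently the right
  action of \<open>\<Sum> \<eta>\<^sub>j y\<^sub>j\<close> is independent of the decomposition.\<close>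

lemma right_act_form:
  assumes "locally_finite \<eta>" "locally_finite y"
  shows "right_act (right_form h \<eta>) y = Jop (adj (\<eta> \<cdot> y) (Jop h))"
  unfolding right_act_eq right_form_eq J_J VV.linear_neg[OF adj_linear] J_minus minus_minus
    adj_comp[OF assms] o_apply ..

lemma right_act_id: "right_act h id = h"
  unfolding right_act_eq adj_id id_apply J_J by simp

lemma right_act_add:
  assumes "locally_finite x" "locally_finite y"
  shows "right_act h (x + y) = right_act h x + right_act h y"
  unfolding right_act_eq adj_add[OF assms] oper_apply J_add by simp

lemma one_forms_lf:
  assumes "\<eta> \<in> one_forms D B" "locally_finite D" "\<And>x. x \<in> B \<Longrightarrow> locally_finite x"
  shows "locally_finite \<eta>"
  using assms(1) unfolding one_forms_def
proof (induction rule: O.span_induct_alt)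
  case (step c x y)
  then obtain p q where x: "x = p \<cdot> comm D q" and "p \<in> B" "q \<in> B" by blast
  then have "locally_finite x" unfolding x by (intro lf_comp lf_comm assms(2,3))
  then show ?case by (intro lf_add lf_scale step(2))
qed (rule lf_zero)

text \<open>The last sum is \<open>J [H, x]\<^sup>* J h = J x\<^sup>* H J h - J H x\<^sup>* J h\<close>. As \<open>H\<close> commutes with \<open>J\<close>, the first term cancels \<open>(H h) x\<close> and the
  second one is \<open>H (h x)\<close>.\<close>

lemma hor_right_act:
  assumes x: "x \<in> sphere3 \<theta>"
    and \<eta>: "\<And>j. j < N \<Longrightarrow> \<eta> j \<in> one_forms (dirac r \<alpha> s) (invariants (sphere3 \<theta>))"
    and y: "\<And>j. j < N \<Longrightarrow> y j \<in> sphere3 \<theta>"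
    and dec: "comm (hor_op s) x = (\<Sum>j<N::nat. \<eta> j \<cdot> y j)"
  shows "hor_op s (right_act h x) =
    right_act (hor_op s h) x + (\<Sum>j<N. right_act (right_form h (\<eta> j)) (y j))"
proof -
  let ?H = "hor_op s"
  have lf: "locally_finite (\<eta> j)" "locally_finite (y j)" if "j < N" for j
    using one_forms_lf[OF \<eta>[OF that] lf_dirac] y[OF that] by (auto intro: sphere3_lf dest: alg_deg_sphere3)
  have "(\<Sum>j<N. right_act (right_form h (\<eta> j)) (y j)) = (\<Sum>j<N. Jop (adj (\<eta> j \<cdot> y j) (Jop h)))"
    by (rule sum.cong) (auto simp: right_act_form lf)
  also have "\<dots> = Jop (adj (\<Sum>j<N. \<eta> j \<cdot> y j) (Jop h))"
    by (subst adj_sum) (auto simp: lf lf_comp J_sum sum_fun_apply)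
  also have "\<dots> = Jop (adj x (?H (Jop h))) - Jop (?H (adj x (Jop h)))"
    unfolding dec[symmetric] comm_def adj_diff[OF lf_comp[OF lf_hor sphere3_lf[OF x]] lf_comp[OF sphere3_lf[OF x] lf_hor]]
      adj_comp[OF lf_hor sphere3_lf[OF x]] adj_comp[OF sphere3_lf[OF x] lf_hor] adj_hor
      oper_apply o_apply J_diff ..
  finally show ?thesis
    unfolding right_act_eq J_hor VV.linear_neg[OF lf_linear[OF lf_hor]] by simp
qed

lemma hor_forms_decompose:
  assumes "z \<in> hor_forms D A"
  obtains N :: nat and \<eta> y where "\<And>j. j < N \<Longrightarrow> \<eta> j \<in> one_forms D (invariants A)"
    "\<And>j. j < N \<Longrightarrow> y j \<in> A" "z = (\<Sum>j<N. \<eta> j \<cdot> y j)"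
proof -
  have "\<exists>(N::nat) \<eta> y. (\<forall>j<N. \<eta> j \<in> one_forms D (invariants A) \<and> y j \<in> A) \<and> z = (\<Sum>j<N. \<eta> j \<cdot> y j)"
    using assms unfolding hor_forms_def
  proof (induction rule: O.span_induct_alt)
    case base
    show ?case by (rule exI[of _ 0]) simp
  next
    case (step c x z)
    obtain \<eta>' x' where x: "x = \<eta>' \<cdot> x'" "\<eta>' \<in> one_forms D (invariants A)" "x' \<in> A"
      using step(1) by blast
    obtain N :: nat and \<eta> y where z: "\<forall>j<N. \<eta> j \<in> one_forms D (invariants A) \<and> y j \<in> A"
      "z = (\<Sum>j<N. \<eta> j \<cdot> y j)"
      using step(2) by (elim exE conjE)
    have "c *\<^sub>O \<eta>' \<in> one_forms D (invariants A)"
      using x(2) by (rule O.subspace_scale[OF one_forms_subspace])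
    moreover have "c *\<^sub>O x + z = (\<Sum>j<Suc N. (\<eta>(N := c *\<^sub>O \<eta>')) j \<cdot> (y(N := x')) j)"
      unfolding x(1) z(2) by (simp add: comp_distrib_left add.commute)
    moreover have "\<forall>j<Suc N. (\<eta>(N := c *\<^sub>O \<eta>')) j \<in> one_forms D (invariants A) \<and> (y(N := x')) j \<in> A"
      using calculation(1) x(3) z(1) by (simp add: less_Suc_eq)
    ultimately show ?case by blast
  qed
  then show thesis using that by blast
qed

lemma is_twisted_dirac_hor:
  "is_twisted_dirac (dirac r \<alpha> s) (sphere3 \<theta>) (omega \<theta> (dirac r \<alpha> s)) (hor_op s)"
  unfolding is_twisted_dirac_def dirac_hor_dirac
proof (intro conjI ballI allI impI)
  fix h k x N and \<eta> y :: "nat \<Rightarrow> oper"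
  assume a: "h \<in> hilb_deg 0 \<inter> dom_hor (dirac r \<alpha> s) \<and> x \<in> alg_deg (sphere3 \<theta>) k \<and>
     (\<forall>j<N. \<eta> j \<in> one_forms (dirac r \<alpha> s) (invariants (sphere3 \<theta>)) \<and> y j \<in> sphere3 \<theta>) \<and>
     nabla (dirac r \<alpha> s) (omega \<theta> (dirac r \<alpha> s)) x = (\<Sum>j<N. \<eta> j \<cdot> y j)"
  then have x: "x \<in> sphere3 \<theta>" by (blast dest: alg_deg_sphere3)
  show "hor_op s (right_act h x) =
    right_act (hor_op s h) x + (\<Sum>j<N. right_act (right_form h (\<eta> j)) (y j))"
    using a nabla_eq[OF x] by (intro hor_right_act[OF x]) auto
qed (rule VV.linear_add[OF lf_linear[OF lf_hor]] VV.linear_scale[OF lf_linear[OF lf_hor]])+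

text \<open>Since \<open>\<nabla>(x)\<close> has a decomposition at all, the value of a twisted operator on \<open>h x\<close> is
  prescribed.\<close>

lemma twisted_dirac_unique:
  assumes T: "is_twisted_dirac (dirac r \<alpha> s) (sphere3 \<theta>) (omega \<theta> (dirac r \<alpha> s)) T"
    and v: "v \<in> twisted_dom (dirac r \<alpha> s) (sphere3 \<theta>)"
  shows "T v = hor_op s v"
proof -
  let ?D = "dirac r \<alpha> s" and ?A = "sphere3 \<theta>"
  let ?S = "{right_act h x | h x k. h \<in> hilb_deg 0 \<inter> dom_hor ?D \<and> x \<in> alg_deg ?A k}"
  have add: "T (u + w) = T u + T w" if "u \<in> twisted_dom ?D ?A" "w \<in> twisted_dom ?D ?A" for u w
    using T that by (simp add: is_twisted_dirac_def)
  have scale: "T (c *\<^sub>V u) = c *\<^sub>V T u" if "u \<in> twisted_dom ?D ?A" for c u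
    using T that by (simp add: is_twisted_dirac_def)
  have gen: "T u = hor_op s u" if "u \<in> ?S" for u
  proof -
    from that obtain h x k where u: "u = right_act h x" and h: "h \<in> hilb_deg 0 \<inter> dom_hor ?D"
      and x: "x \<in> alg_deg ?A k" by blast
    obtain N \<eta> y where dec: "\<And>j. j < N \<Longrightarrow> \<eta> j \<in> one_forms ?D (invariants ?A)"
      "\<And>j. j < N \<Longrightarrow> y j \<in> ?A" "comm (hor_op s) x = (\<Sum>j<N::nat. \<eta> j \<cdot> y j)"
      using hor_forms_decompose[OF hor_form_homogeneous[OF x]] by blast
    have "nabla ?D (omega \<theta> ?D) x = (\<Sum>j<N. \<eta> j \<cdot> y j)"
      unfolding nabla_eq[OF alg_deg_sphere3[OF x]] by (rule dec(3))
    then have "T u = right_act (dirac_hor ?D h) x + (\<Sum>j<N. right_act (right_form h (\<eta> j)) (y j))"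
      using T h x dec(1,2) unfolding is_twisted_dirac_def u by blast
    also have "\<dots> = hor_op s u"
      unfolding u dirac_hor_dirac
      by (rule hor_right_act[OF alg_deg_sphere3[OF x] dec, symmetric])
    finally show ?thesis .
  qed
  have "T v = hor_op s v \<and> v \<in> twisted_dom ?D ?A"
    using v unfolding twisted_dom_def
  proof (induction rule: V.span_induct_alt)
    case base
    have "0 \<in> twisted_dom ?D ?A" unfolding twisted_dom_def by (rule V.span_zero)
    from scale[OF this, of 0] have "T 0 = 0" by (simp only: V.scale_zero_left)
    then show ?case using V.span_zero VV.linear_0[OF lf_linear[OF lf_hor]] by metis
  next
    case (step c u w)
    then have u: "u \<in> twisted_dom ?D ?A" and w: "w \<in> twisted_dom ?D ?A"
      unfolding twisted_dom_def by (blast intro: V.span_base)+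
    then have cu: "c *\<^sub>V u \<in> twisted_dom ?D ?A"
      unfolding twisted_dom_def by (intro V.span_scale)
    have "T (c *\<^sub>V u + w) = c *\<^sub>V hor_op s u + hor_op s w"
      unfolding add[OF cu w] scale[OF u] gen[OF step(1)] using step(2) by simp
    also have "\<dots> = hor_op s (c *\<^sub>V u + w)"
      unfolding VV.linear_add[OF lf_linear[OF lf_hor]] VV.linear_scale[OF lf_linear[OF lf_hor]] ..
    finally show ?case
      using V.span_add[OF cu[unfolded twisted_dom_def] w[unfolded twisted_dom_def]] by (intro conjI)
  qed
  then show ?thesis by (rule conjunct1)
qed


section \<open>Vectors of finite support\<close>

lemma finsupp_hilb: "finsupp \<subseteq> hilb"
proof
  fix v assume "v \<in> finsupp"
  then have fin: "finite {i. v i \<noteq> 0}" by (simp add: finsupp_def)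
  have "(\<lambda>i. (cmod (v i))\<^sup>2) summable_on {i. v i \<noteq> 0}"
    using fin by (rule summable_on_finite)
  then have "(\<lambda>i. (cmod (v i))\<^sup>2) summable_on UNIV"
    by (subst summable_on_cong_neutral[of "{i. v i \<noteq> 0}" UNIV]) auto
  then show "v \<in> hilb" by (simp add: hilb_def)
qed

lemma finsupp_dense: "dense_in_hilb finsupp"
  unfolding dense_in_hilb_def
proof (intro conjI finsupp_hilb ballI allI impI)
  fix v and \<epsilon> :: real assume v: "v \<in> hilb" and \<epsilon>: "0 < \<epsilon>"
  define f where "f i = (cmod (v i))\<^sup>2" for i
  have f: "f summable_on UNIV" using v unfolding hilb_def f_def[abs_def] by simp
  obtain F where F: "finite F" "dist (sum f F) (infsum f UNIV) \<le> \<epsilon>\<^sup>2 / 2"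
    using infsum_finite_approximation[OF f, of "\<epsilon>\<^sup>2 / 2"] \<epsilon> by auto
  \<comment> \<open>The truncation of \<open>v\<close> to \<open>F\<close>; its squared distance to \<open>v\<close> is the tail of the sum.\<close>
  define w where "w i = (if i \<in> F then v i else 0)" for i
  have "{i. w i \<noteq> 0} \<subseteq> F" by (auto simp: w_def split: if_splits)
  then have w: "w \<in> finsupp" using F(1) by (simp add: finsupp_def finite_subset)
  have "(\<Sum>\<^sub>\<infinity>i. (cmod ((v - w) i))\<^sup>2) = infsum f (UNIV - F)"
    by (rule infsum_cong_neutral) (auto simp: w_def f_def pointwise)
  also have "\<dots> = infsum f UNIV - sum f F"
    using f F(1) by (subst infsum_Diff) auto
  also have "\<dots> \<le> \<epsilon>\<^sup>2 / 2"
    using F(2) unfolding dist_real_def by linarith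
  also have "\<dots> < \<epsilon>\<^sup>2" using \<epsilon> by simp
  finally have "hnorm (v - w) < \<epsilon>"
    unfolding hnorm_def using \<epsilon> by (intro real_less_lsqrt) auto
  then show "\<exists>w\<in>finsupp. hnorm (v - w) < \<epsilon>" using w by blast
qed

lemma finsupp_dom_hor: "finsupp \<subseteq> dom_hor (dirac r \<alpha> s)"
  using finsupp_hilb lf_finsupp[OF lf_hor] by (auto simp: dom_hor_def dirac_hor_dirac)

lemma right_act_finsupp:
  assumes "x \<in> sphere3 \<theta>" "v \<in> finsupp"
  shows "right_act v x \<in> finsupp"
  unfolding right_act_eq
  using J_finsupp[OF lf_finsupp[OF lf_adj[OF sphere3_lf[OF assms(1)]] J_finsupp[OF assms(2)]]]
    V.subspace_neg[OF finsupp_subspace] by blast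

text \<open>Both \<open>J\<close> and \<open>adj\<close> reverse degrees, so the degree of \<open>x\<close> is added.\<close>

lemma delta_right_act:
  assumes x: "x \<in> alg_deg (sphere3 \<theta>) k" and v: "\<delta>op v = of_int l *\<^sub>V v"
  shows "\<delta>op (right_act v x) = of_int (l + k) *\<^sub>V right_act v x"
proof -
  let ?w = "adj x (Jop v)"
  have "comm \<delta>op (adj x) (Jop v) = of_int (- k) *\<^sub>V ?w"
    using alg_deg_adj[OF x] by (simp add: alg_deg_def)
  moreover have "\<delta>op (Jop v) = - of_int l *\<^sub>V Jop v"
    using J_delta[of v] unfolding v J_scale by (metis V.scale_minus_left complex_cnj_of_int minus_minus)
  moreover have "adj x (- of_int l *\<^sub>V Jop v) = - of_int l *\<^sub>V ?w"
    by (rule VV.linear_scale[OF adj_linear])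
  ultimately have "\<delta>op ?w - - of_int l *\<^sub>V ?w = of_int (- k) *\<^sub>V ?w"
    by (simp only: comm_def oper_apply o_apply)
  then have "\<delta>op ?w = of_int (- k) *\<^sub>V ?w + - of_int l *\<^sub>V ?w"
    by (simp only: diff_eq_eq)
  also have "\<dots> = (- of_int (l + k)) *\<^sub>V ?w"
    unfolding V.scale_left_distrib[symmetric] by (rule arg_cong[of _ _ "\<lambda>c. c *\<^sub>V ?w"]) simp
  finally have w: "\<delta>op ?w = (- of_int (l + k)) *\<^sub>V ?w" .
  have "\<delta>op (- Jop ?w) = Jop (\<delta>op ?w)"
    unfolding J_delta VV.linear_neg[OF lf_linear[OF lf_delta]] ..
  also have "\<dots> = of_int (l + k) *\<^sub>V (- Jop ?w)"
    unfolding w V.scale_minus_left V.scale_minus_right J_minus J_scale complex_cnj_minus complex_cnj_of_int ..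
  finally show ?thesis unfolding right_act_eq .
qed

text \<open>A vector of degree \<open>k \<noteq> 0\<close> is replaced by the vectors \<open>v u\<^sub>i\<close>, of degree closer to \<open>0\<close>, at the expense of
  acting by \<open>v\<^sub>i y\<close> in place of \<open>y\<close>; hence the statement is about \<open>v y\<close> for all homogeneous \<open>y\<close>.\<close>

lemma right_act_twisted_dom:
  assumes "v \<in> finsupp" "\<delta>op v = of_int k *\<^sub>V v" "y \<in> alg_deg (sphere3 \<theta>) l"
  shows "right_act v y \<in> twisted_dom (dirac r \<alpha> s) (sphere3 \<theta>)"
  using assms
proof (induction "nat \<bar>k\<bar>" arbitrary: v k y l)
  case 0
  then have "v \<in> hilb_deg 0 \<inter> dom_hor (dirac r \<alpha> s)"
    using finsupp_hilb finsupp_dom_hor[of r \<alpha> s] by (auto simp: hilb_deg_def)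
  then show ?case unfolding twisted_dom_def using 0(4) by (intro V.span_base) blast
next
  case (Suc n)
  have "sgn k = 1 \<or> sgn k = - 1" using Suc(2) by (auto simp: sgn_if)
  then obtain u1 v1 u2 v2 where u: "u1 \<in> alg_deg (sphere3 \<theta>) (- sgn k)" "u2 \<in> alg_deg (sphere3 \<theta>) (- sgn k)"
    and v: "v1 \<in> alg_deg (sphere3 \<theta>) (sgn k)" "v2 \<in> alg_deg (sphere3 \<theta>) (sgn k)"
    and unit: "u1 \<cdot> v1 + u2 \<cdot> v2 = id"
    by (rule flat_partition)
  have n: "n = nat \<bar>k + - sgn k\<bar>" using Suc(2) by (auto simp: sgn_if)
  note A = u[THEN alg_deg_sphere3] v[THEN alg_deg_sphere3] alg_deg_sphere3[OF Suc(5)]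
  have IH: "right_act (right_act v u) (w \<cdot> y) \<in> twisted_dom (dirac r \<alpha> s) (sphere3 \<theta>)"
    if "u \<in> alg_deg (sphere3 \<theta>) (- sgn k)" "w \<in> alg_deg (sphere3 \<theta>) (sgn k)" for u w
    by (rule Suc(1)[OF n right_act_finsupp[OF alg_deg_sphere3[OF that(1)] Suc(3)]
          delta_right_act[OF that(1) Suc(4)] alg_deg_mult[OF that(2) Suc(5)]])
  have lf: "locally_finite u1" "locally_finite u2" "locally_finite (v1 \<cdot> y)" "locally_finite (v2 \<cdot> y)"
    using A by (auto intro: sphere3_lf lf_comp)
  have "y = (u1 \<cdot> v1 + u2 \<cdot> v2) \<cdot> y" unfolding unit by simp
  also have "\<dots> = u1 \<cdot> (v1 \<cdot> y) + u2 \<cdot> (v2 \<cdot> y)"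
    by (simp only: comp_distrib_left comp_assoc)
  finally have "right_act v y = right_act v (u1 \<cdot> (v1 \<cdot> y) + u2 \<cdot> (v2 \<cdot> y))" by simp
  also have "\<dots> = right_act (right_act v u1) (v1 \<cdot> y) + right_act (right_act v u2) (v2 \<cdot> y)"
    by (simp only: right_act_add[OF lf_comp[OF lf(1,3)] lf_comp[OF lf(2,4)]]
        right_act_comp[OF lf(1,3)] right_act_comp[OF lf(2,4)])
  also have "\<dots> \<in> twisted_dom (dirac r \<alpha> s) (sphere3 \<theta>)"
    using V.span_add[OF IH[OF u(1) v(1), unfolded twisted_dom_def] IH[OF u(2) v(2), unfolded twisted_dom_def]]
    unfolding twisted_dom_def .
  finally show ?case .
qed

lemma finsupp_twisted_dom: "finsupp \<subseteq> twisted_dom (dirac r \<alpha> s) (sphere3 \<theta>)"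
proof -
  have "unit_vec j \<in> twisted_dom (dirac r \<alpha> s) (sphere3 \<theta>)" for j
  proof -
    obtain l m n \<sigma> where j: "Rep_label j = (l, m, n, \<sigma>)" by (cases "Rep_label j")
    obtain a b where "l + m = of_nat a" "l - m = of_nat b"
      using Rep_label_conds[OF j] by (auto elim!: Nats_cases)
    then have "2 * m = of_int (int a - int b)" by simp
    then obtain k where k: "2 * m + spin_sign \<sigma> = of_int k"
      by (cases \<sigma>) (auto intro: that[of "int a - int b + 1"] that[of "int a - int b - 1"])
    have "\<delta>op (unit_vec j) = of_int k *\<^sub>V unit_vec j"
    proof (rule vec_eqI)
      fix l' m' n' \<sigma>'
      show "coef (\<delta>op (unit_vec j)) (l', m', n', \<sigma>') = coef (of_int k *\<^sub>V unit_vec j) (l', m', n', \<sigma>')"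
        using arg_cong[OF k, of complex_of_real] by (auto simp: coef_delta coef_scale coef_unit_vec j)
    qed
    from right_act_twisted_dom[OF unit_vec_finsupp this alg_deg_id] show ?thesis
      unfolding right_act_id .
  qed
  then have "V.span (range unit_vec) \<subseteq> twisted_dom (dirac r \<alpha> s) (sphere3 \<theta>)"
    unfolding twisted_dom_def by (intro V.span_minimal V.subspace_span) blast
  then show ?thesis unfolding finsupp_eq_span .
qed

lemma compatible_omega:
  "compatible (dirac r \<alpha> s) (sphere3 \<theta>) (omega \<theta> (dirac r \<alpha> s))"
  unfolding compatible_def
proof (intro conjI exI allI impI)
  show "is_twisted_dirac (dirac r \<alpha> s) (sphere3 \<theta>) (omega \<theta> (dirac r \<alpha> s)) (hor_op s)"
    by (rule is_twisted_dirac_hor)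
  fix T assume T: "is_twisted_dirac (dirac r \<alpha> s) (sphere3 \<theta>) (omega \<theta> (dirac r \<alpha> s)) T"
  show "dense_in_hilb finsupp" by (rule finsupp_dense)
  show "finsupp \<subseteq> twisted_dom (dirac r \<alpha> s) (sphere3 \<theta>) \<inter> dom_hor (dirac r \<alpha> s)"
    using finsupp_twisted_dom finsupp_dom_hor by blast
  show "\<forall>v\<in>finsupp. T v = dirac_hor (dirac r \<alpha> s) v"
    unfolding dirac_hor_dirac using twisted_dirac_unique[OF T] finsupp_twisted_dom by blast
qed

theorem theorem7p6:
  fixes \<theta> r \<alpha> :: real and s :: complex
  assumes "\<forall>k::nat. k > 0 \<longrightarrow> lam \<theta> 1 ^ k \<noteq> 1"
    and "r \<noteq> 0"
  shows "strong_connection (dirac r \<alpha> s) (sphere3 \<theta>) (omega \<theta> (dirac r \<alpha> s)) \<and>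
         compatible (dirac r \<alpha> s) (sphere3 \<theta>) (omega \<theta> (dirac r \<alpha> s))"
  using strong_connection_omega[OF assms(2)] compatible_omega by blast

end
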